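(* Let $(M_k)_{k\ge 1}$ be i.i.d. random matrices uniformly distributed on the nine-element set $\{E_0,E_1,\dots,E_8\}$, and let $z$ be a point of the interior of $D$. Put $V_n^z=h_{M_1}\circ\cdots\circ h_{M_n}(z)$ for $n\ge 1$ (so that the tiles $h_{M_1\cdots M_n}(D)\ni V_n^z$ form the simple random walk, started at $D$, on the graph of tiles). Then, with probability $1$, $V_n^z$ converges as $n\to\infty$ to a random point $X$ of the real line, and $X$ has the same distribution as $S_2W^{S_1}$, where $S_1,S_2,W$ are independent, $\Pr(S_i=1)=\Pr(S_i=-1)=1/2$ for $i=1,2$, and $W$ takes values in $(0,1)$ with distribution function $\Pr(W<w)=\mathbf{?}(w)$, $\mathbf{?}$ being the Minkowski question mark function.
   Context: $H=\{z\in\mathbb{C}:\operatorname{Im} z>0\}$ and $G=SL_2(\mathbb{Z})/\{\pm I\}$. For $M=\pm\begin{pmatrix}a&b\\c&d\end{pmatrix}\in G$, $h_M(z)=\frac{az+b}{cz+d}$. $D=\{z\in H:|z|\ge 1,\ |\operatorname{Re} z|\le 1/2\}$. The tiles $h_M(D)$, $M\in G$, are the vertices of a graph in which two distinct tiles $h_M(D)$ and $h_{M'}(D)$ are neighbours when $h_M(D)\cap h_{M'}(D)\ne\emptyset$, equivalently when $M^{-1}M'\in\{\pm E_0,\dots,\pm E_8\}$. Here $E_0,\dots,E_8$ are the elements $M$ of $G$, different from the identity, with $\operatorname{tr}(MM^T)\le 3$; the corresponding maps $h_i=h_{E_i}$ are $h_0(z)=-1/z$, $h_1(z)=1+z$,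 $h_2(z)=-1+z$, $h_3(z)=1-1/z$, $h_4(z)=-1-1/z$, $h_5(z)=z/(1+z)$, $h_6(z)=z/(1-z)$, $h_7(z)=-1/(1+z)$, $h_8(z)=1/(1-z)$. For positive integers $k_1,k_2,\dots$, $[k_1,k_2,\dots]=\frac{1}{k_1+\frac{1}{k_2+\cdots}}$ denotes the infinite continued fraction; every irrational number in $(0,1)$ has a unique such expansion. The Minkowski question mark function is defined at irrational points of $(0,1)$ by $\mathbf{?}([k_1,k_2,\dots])=2\sum_{n=1}^\infty(-1)^{n+1}2^{-\sum_{j=1}^n k_j}$ and extended by continuity to $[0,1]$. *)

theory Defs
  imports "HOL-Probability.Probability"
begin

definition sl2z :: "(int^2^2) set" where
  "sl2z = {A. det A = 1}"

lemma sl2z_uminus [simp]: "- A \<in> sl2z \<longleftrightarrow> A \<in> sl2z"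
  by (simp add: sl2z_def det_2)

lemma sl2z_mult: "A \<in> sl2z \<Longrightarrow> B \<in> sl2z \<Longrightarrow> A ** B \<in> sl2z"
  by (simp add: sl2z_def det_mul)

lemma sl2z_one: "mat 1 \<in> sl2z"
  by (simp add: sl2z_def det_I)

quotient_type psl2z = "int^2^2" / partial:
  "\<lambda>A B. A \<in> sl2z \<and> B \<in> sl2z \<and> (A = B \<or> A = - B)"
proof (rule part_equivpI)
  show "\<exists>A. A \<in> sl2z \<and> A \<in> sl2z \<and> (A = A \<or> A = - A)"
    using sl2z_one by blast
qed (auto simp: symp_def transp_def)

lemma matrix_mult_uminus_left: "(- A) ** B = - (A ** (B :: int^2^2))"
  by (simp add: matrix_matrix_mult_def vec_eq_iff sum_negf)

lemma matrix_mult_uminus_right: "A ** (- B) = - (A ** (B :: int^2^2))"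
  by (simp add: matrix_matrix_mult_def vec_eq_iff sum_negf)

instantiation psl2z :: monoid_mult
begin

lift_definition one_psl2z :: psl2z is "mat 1"
  by (simp add: sl2z_one)

lift_definition times_psl2z :: "psl2z \<Rightarrow> psl2z \<Rightarrow> psl2z" is "(**)"
  by (auto simp: sl2z_mult matrix_mult_uminus_left matrix_mult_uminus_right)

instance
  by standard (transfer, auto simp: sl2z_mult sl2z_one matrix_mul_assoc)+

end

lift_definition mobius :: "psl2z \<Rightarrow> complex \<Rightarrow> complex" is
  "\<lambda>A z. (of_int (A$1$1) * z + of_int (A$1$2)) / (of_int (A$2$1) * z + of_int (A$2$2))"
proof (elim conjE disjE)
  fix A B :: "int^2^2"
  assume "A = - B"
  have "(- p * z - q) / (- r * z - s) = (p * z + q) / (r * z + s)" for p q r s z :: complex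
    using minus_divide_divide [of "p * z + q" "r * z + s"] by simp
  then show "(\<lambda>z. (of_int (A$1$1) * z + of_int (A$1$2)) / (of_int (A$2$1) * z + of_int (A$2$2)))
      = (\<lambda>z. (of_int (B$1$1) * z + of_int (B$1$2)) /
             (of_int (B$2$1) * z + of_int (B$2$2)) :: complex)"
    by (simp add: \<open>A = - B\<close>)
qed auto

lift_definition tr_sq :: "psl2z \<Rightarrow> int" is "\<lambda>A. trace (A ** transpose A)"
  by (auto simp: trace_def matrix_matrix_mult_def transpose_def)

definition steps :: "psl2z set" where
  "steps = {M. M \<noteq> 1 \<and> tr_sq M \<le> 3}"

lemma tr_sq_abs:
  "A \<in> sl2z \<Longrightarrow> tr_sq (abs_psl2z A) = (A$1$1)\<^sup>2 + (A$1$2)\<^sup>2 + (A$2$1)\<^sup>2 + (A$2$2)\<^sup>2"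
  by (simp add: tr_sq.abs_eq trace_def matrix_matrix_mult_def transpose_def sum_2 power2_eq_square)

abbreviation psl2z_of :: "int \<Rightarrow> int \<Rightarrow> int \<Rightarrow> int \<Rightarrow> psl2z" where
  "psl2z_of a b c d \<equiv> abs_psl2z (vector [vector [a, b], vector [c, d]])"

lemma psl2z_abs_eq_iff:
  assumes "A \<in> sl2z" "B \<in> sl2z"
  shows "abs_psl2z A = abs_psl2z B \<longleftrightarrow> A = B \<or> A = - B"
  using assms Quotient_rel [OF Quotient_psl2z, of A B] by auto

lemma psl2z_of_eq_iff:
  assumes "a * d - b * c = 1" "a' * d' - b' * c' = 1"
  shows "psl2z_of a b c d = psl2z_of a' b' c' d' \<longleftrightarrow>
     (a = a' \<and> b = b' \<and> c = c' \<and> d = d') \<or> (a = - a' \<and> b = - b' \<and> c = - c' \<and> d = - d')"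
  by (subst psl2z_abs_eq_iff)
     (use assms in \<open>auto simp: sl2z_def det_2 vec_eq_iff forall_2\<close>)

lemma psl2z_exhaust:
  obtains a b c d where "M = psl2z_of a b c d" "a * d - b * c = 1"
proof -
  obtain A where A: "A \<in> sl2z" "M = abs_psl2z A"
    using Quotient_abs_rep [OF Quotient_psl2z, of M] Quotient_rep_reflp [OF Quotient_psl2z, of M]
    by auto
  have "A = vector [vector [A$1$1, A$1$2], vector [A$2$1, A$2$2]]"
    by (simp add: vec_eq_iff forall_2)
  with A show thesis
    using that [of "A$1$1" "A$1$2" "A$2$1" "A$2$2"] by (simp add: sl2z_def det_2)
qed

lemma one_psl2z_eq: "1 = psl2z_of 1 0 0 1"
proof -
  have "mat 1 = (vector [vector [1, 0], vector [0, 1]] :: int^2^2)"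
    by (simp add: vec_eq_iff forall_2 mat_def)
  then show ?thesis
    by (simp add: one_psl2z.abs_eq)
qed

lemma tr_sq_of:
  "a * d - b * c = 1 \<Longrightarrow> tr_sq (psl2z_of a b c d) = a\<^sup>2 + b\<^sup>2 + c\<^sup>2 + d\<^sup>2"
  by (subst tr_sq_abs) (auto simp: sl2z_def det_2)

lemma mobius_of:
  "a * d - b * c = 1 \<Longrightarrow>
     mobius (psl2z_of a b c d) z = (of_int a * z + of_int b) / (of_int c * z + of_int d)"
  by (subst mobius.abs_eq) (auto simp: sl2z_def det_2)

text \<open>The elements below are, in this order, the matrices of $-1/z$, $1+z$, $-1+z$, $1-1/z$,
  $-1-1/z$, $z/(1+z)$, $z/(1-z)$, $-1/(1+z)$ and $1/(1-z)$.\<close>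

lemma steps_eq:
  "steps = {psl2z_of 0 (-1) 1 0, psl2z_of 1 1 0 1, psl2z_of 1 (-1) 0 1,
            psl2z_of 1 (-1) 1 0, psl2z_of (-1) (-1) 1 0, psl2z_of 1 0 1 1,
            psl2z_of 1 0 (-1) 1, psl2z_of 0 (-1) 1 1, psl2z_of 0 1 (-1) 1}" (is "_ = ?R")
proof
  show "steps \<subseteq> ?R"
  proof
    fix M assume M: "M \<in> steps"
    obtain a b c d where eq: "M = psl2z_of a b c d" and det: "a * d - b * c = 1"
      by (rule psl2z_exhaust)
    have le: "a\<^sup>2 + b\<^sup>2 + c\<^sup>2 + d\<^sup>2 \<le> 3"
      using M tr_sq_of [OF det] by (simp add: steps_def eq)
    have small: "x = - 1 \<or> x = 0 \<or> x = 1" if "x\<^sup>2 \<le> 3" for x :: int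
    proof -
      have "\<bar>x\<bar> < 2"
        using that power_mono [of 2 "\<bar>x\<bar>" 2] by (force simp: not_less)
      then show ?thesis by linarith
    qed
    have "a = - 1 \<or> a = 0 \<or> a = 1" "b = - 1 \<or> b = 0 \<or> b = 1"
         "c = - 1 \<or> c = 0 \<or> c = 1" "d = - 1 \<or> d = 0 \<or> d = 1"
      using le zero_le_power2 [of a] zero_le_power2 [of b] zero_le_power2 [of c]
        zero_le_power2 [of d] by (intro small; linarith)+
    moreover have "\<not> (b = 0 \<and> c = 0)"
    proof
      assume bc: "b = 0 \<and> c = 0"
      with det have "a = 1 \<and> d = 1 \<or> a = - 1 \<and> d = - 1"
        by (simp add: zmult_eq_1_iff)
      with bc have "M = 1"
        by (auto simp: eq one_psl2z_eq psl2z_of_eq_iff)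
      with M show False by (simp add: steps_def)
    qed
    ultimately show "M \<in> ?R"
      unfolding eq using le det by (elim disjE; simp add: psl2z_of_eq_iff)
  qed
  show "?R \<subseteq> steps"
    by (simp add: steps_def one_psl2z_eq psl2z_of_eq_iff tr_sq_of)
qed

lemma card_steps: "card steps = 9"
  by (simp add: steps_eq psl2z_of_eq_iff)

definition fund_dom :: "complex set" where
  "fund_dom = {z. Im z > 0 \<and> cmod z \<ge> 1 \<and> \<bar>Re z\<bar> \<le> 1 / 2}"

definition tile :: "psl2z \<Rightarrow> complex set" where
  "tile M = mobius M ` fund_dom"

definition tile_adj :: "complex set \<Rightarrow> complex set \<Rightarrow> bool" where
  "tile_adj S T \<longleftrightarrow> S \<in> range tile \<and> T \<in> range tile \<and> S \<noteq> T \<and> S \<inter> T \<noteq> {}"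

definition simple_random_walk ::
    "'a measure \<Rightarrow> ('v \<Rightarrow> 'v \<Rightarrow> bool) \<Rightarrow> 'v \<Rightarrow> (nat \<Rightarrow> 'a \<Rightarrow> 'v) \<Rightarrow> bool" where
  "simple_random_walk P adj v0 T \<longleftrightarrow>
     (\<forall>n. T n \<in> measurable P (count_space UNIV)) \<and>
     (AE \<omega> in P. T 0 \<omega> = v0) \<and>
     (\<forall>n v w. measure P {\<omega> \<in> space P. (\<forall>i\<le>n. T i \<omega> = v i) \<and> T (Suc n) \<omega> = w} =
        measure P {\<omega> \<in> space P. \<forall>i\<le>n. T i \<omega> = v i} *
          (if adj (v n) w then 1 / real (card {u. adj (v n) u}) else 0))"

text \<open>The partial quotients $k_1, k_2, \dots$ are \<open>k 0\<close>, \<open>k 1\<close>, and so on.\<close>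

fun cf_convergent :: "(nat \<Rightarrow> nat) \<Rightarrow> nat \<Rightarrow> real" where
  "cf_convergent k 0 = 0"
| "cf_convergent k (Suc n) = 1 / (real (k 0) + cf_convergent (\<lambda>i. k (Suc i)) n)"

definition cf_expansion :: "(nat \<Rightarrow> nat) \<Rightarrow> real \<Rightarrow> bool" where
  "cf_expansion k x \<longleftrightarrow> (\<forall>i. k i > 0) \<and> cf_convergent k \<longlonglongrightarrow> x"

definition question_mark_irrational :: "real \<Rightarrow> real" where
  "question_mark_irrational x =
     (let k = (THE k. cf_expansion k x) in 2 * (\<Sum>n. (- 1) ^ n * (1 / 2) ^ (\<Sum>j\<le>n. k j)))"

definition question_mark :: "real \<Rightarrow> real" where
  "question_mark x =
     (if x \<in> {0<..<1} - \<rat> then question_mark_irrational x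
      else Lim (at x within {0<..<1} - \<rat>) question_mark_irrational)"

definition signs_and_minkowski ::
    "'b measure \<Rightarrow> ('b \<Rightarrow> real) \<Rightarrow> ('b \<Rightarrow> real) \<Rightarrow> ('b \<Rightarrow> real) \<Rightarrow> bool" where
  "signs_and_minkowski Q S1 S2 W \<longleftrightarrow>
     prob_space Q \<and>
     prob_space.indep_vars Q (\<lambda>_. borel) (\<lambda>i. [S1, S2, W] ! i) {..<3} \<and>
     (\<forall>S\<in>{S1, S2}. measure Q {\<omega> \<in> space Q. S \<omega> = 1} = 1 / 2 \<and>
                    measure Q {\<omega> \<in> space Q. S \<omega> = - 1} = 1 / 2) \<and>
     (\<forall>\<omega>\<in>space Q. W \<omega> \<in> {0<..<1}) \<and>
     (\<forall>w\<in>{0..1}. measure Q {\<omega> \<in> space Q. W \<omega> < w} = question_mark w)"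

end

theory Submission
  imports Defs
begin

text \<open>
  Why the theorem holds. Put \<open>A n = M 1 * \<dots> * M n\<close>, with bottom row \<open>(c, d)\<close>, which is determined up to
  sign. Three facts about these matrices carry the proof.

  \<^item> Convergence. For points \<open>z\<close>, \<open>w\<close> of the upper half-plane the distance of their images under
    \<open>A n\<close> is \<open>cmod (z - w)\<close> divided by \<open>cmod (c * z + d) * cmod (c * w + d)\<close>, hence of order
    \<open>1 / (c\<^sup>2 + d\<^sup>2)\<close>. Consecutive positions of the walk are the images under \<open>A n\<close> of the starting point and of
    one of its nine translates, so the walk converges as soon as \<open>1 / (c\<^sup>2 + d\<^sup>2)\<close> is summable, and
    the limit is real because imaginary parts are of the same order. Up to order and signs, a step
    keeps the pair \<open>(\<bar>c\<bar>, \<bar>d\<bar>)\<close> or replaces it by one of the four pairs made of one entry and of the sum or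
    difference of the entries: it moves in the tree of the subtractive Euclidean algorithm, with a
    drift away from the root. A potential of the depth makes the summability quantitative
    (\<open>bottom_potential_drift\<close>, \<open>walk_converges\<close>).

  \<^item> A stationary law. Let \<open>\<mu>\<close> be the law of \<open>S2 * W powr S1\<close>. The Minkowski distribution function
    solves a two-branch functional equation, which says that \<open>W\<close> has the law of \<open>W / (1 + W)\<close> or
    \<open>1 / (1 + W)\<close>, chosen by a fair coin. Hence \<open>Y = W powr S1\<close> has the law of \<open>1 + Y\<close> or
    \<open>Y / (1 + Y)\<close>, chosen in the same way, and of \<open>1 / Y\<close>. Expanding the nine images of \<open>\<mu>\<close> by these rules
    shows that \<open>\<mu>\<close> is stationary under a uniformly chosen step (\<open>signed_minkowski_stationary\<close>).

  \<^item> Concentration. The measure \<open>\<mu>\<close> has no atoms and \<open>c\<^sup>2 + d\<^sup>2\<close> tends to infinity, so the image of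
    \<open>\<mu>\<close> under \<open>A n\<close> tends to the point mass at the limit \<open>X\<close> of the walk
    (\<open>pushforward_concentrates\<close>).

  By stationarity the mean over the walk of the image measures is \<open>\<mu>\<close> for each \<open>n\<close>. By concentration it
  tends to the law of \<open>X\<close>. Comparing characteristic functions, \<open>X\<close> has law \<open>\<mu>\<close>.

  That the tiles form the simple random walk is the statement that the tiles meeting the tile of
  \<open>A\<close> are those of \<open>A * s\<close> for the nine steps \<open>s\<close> (\<open>tile_adj_iff\<close>), together with the independence of
  the next step from the past.
\<close>

section \<open>The tessellation and its neighbour graph\<close>

instance psl2z :: countable
proof
  have "(UNIV :: psl2z set) \<subseteq> range abs_psl2z"
    by (metis psl2z_exhaust rangeI subsetI)
  then have "countable (UNIV :: psl2z set)"
    by (rule countable_subset) simp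
  then show "\<exists>f :: psl2z \<Rightarrow> nat. inj f" by (auto simp: countable_def)
qed

lemma psl2z_of_mult:
  assumes "a * d - b * c = 1" "a' * d' - b' * c' = 1"
  shows "psl2z_of a b c d * psl2z_of a' b' c' d' =
    psl2z_of (a * a' + b * c') (a * b' + b * d') (c * a' + d * c') (c * b' + d * d')"
proof -
  have *: "(vector [vector [a, b], vector [c, d]] :: int^2^2) ** vector [vector [a', b'], vector [c', d']] =
      (vector [vector [a * a' + b * c', a * b' + b * d'], vector [c * a' + d * c', c * b' + d * d']]
        :: int^2^2)"
    by (simp add: vec_eq_iff forall_2 matrix_matrix_mult_def sum_2)
  show ?thesis
    by (subst times_psl2z.abs_eq) (use assms in \<open>auto simp: sl2z_def det_2 *\<close>)
qed

lemma psl2z_inverse_ex: "\<exists>B. A * B = 1 \<and> B * A = (1 :: psl2z) \<and> tr_sq B = tr_sq A"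
proof -
  obtain a b c d where A: "A = psl2z_of a b c d" and det: "a * d - b * c = 1"
    by (rule psl2z_exhaust)
  have det': "d * a - (- b) * (- c) = 1" using det by (simp add: algebra_simps)
  show ?thesis
    by (rule exI [of _ "psl2z_of d (- b) (- c) a"])
       (use det det' in \<open>auto simp: A psl2z_of_mult one_psl2z_eq tr_sq_of algebra_simps\<close>)
qed

lemma psl2z_mult_left_cancel: "A * B = A * C \<longleftrightarrow> B = (C :: psl2z)"
proof -
  obtain D where "D * A = 1" using psl2z_inverse_ex by blast
  then show ?thesis by (metis mult.assoc mult_1_left)
qed

lemma denom_nonzero:
  assumes "a * d - b * c = (1 :: int)" "Im z > 0"
  shows "of_int c * z + of_int d \<noteq> 0"
proof
  assume *: "of_int c * z + of_int d = 0"
  then have "Im (of_int c * z + of_int d) = 0" by simp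
  then have "c = 0" using assms(2) by simp
  with * have "d = 0" by simp
  with \<open>c = 0\<close> assms(1) show False by simp
qed

lemma Im_mobius:
  assumes "a * d - b * c = 1"
  shows "Im (mobius (psl2z_of a b c d) z) = Im z / (cmod (of_int c * z + of_int d))\<^sup>2"
proof -
  have det: "real_of_int a * real_of_int d - real_of_int b * real_of_int c = 1"
    using assms by (metis of_int_1 of_int_diff of_int_mult)
  have "Im (mobius (psl2z_of a b c d) z) =
     (real_of_int a * real_of_int d - real_of_int b * real_of_int c) * Im z
        / (cmod (of_int c * z + of_int d))\<^sup>2"
    unfolding mobius_of [OF assms] by (simp add: Im_divide cmod_power2 algebra_simps)
  then show ?thesis by (simp add: det)
qed

text \<open>The non-vanishing hypothesis is on the inner denominator only. If the outer one vanishes, both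
  sides are quotients by zero and equal to 0. This makes the lemma apply to real points too.\<close>

lemma mobius_mult:
  assumes "of_int c * z + of_int d \<noteq> 0" "a * d - b * c = 1"
  shows "mobius (A * psl2z_of a b c d) z = mobius A (mobius (psl2z_of a b c d) z)"
proof -
  obtain a' b' c' d' where A: "A = psl2z_of a' b' c' d'" and det: "a' * d' - b' * c' = 1"
    by (rule psl2z_exhaust)
  have det': "(a' * a + b' * c) * (c' * b + d' * d) - (a' * b + b' * d) * (c' * a + d' * c) = 1"
  proof -
    have "(a' * a + b' * c) * (c' * b + d' * d) - (a' * b + b' * d) * (c' * a + d' * c) =
        (a' * d' - b' * c') * (a * d - b * c)" by algebra
    then show ?thesis using assms det by simp
  qed
  let ?w = "of_int c * z + of_int d"
  have "(of_int p * (of_int a * z + of_int b) / ?w + of_int q) =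
      (of_int (p * a + q * c) * z + of_int (p * b + q * d)) / ?w" for p q
    using assms(1) by (simp add: field_simps)
  then show ?thesis
    using assms(1) unfolding A psl2z_of_mult [OF det assms(2)] mobius_of [OF det']
      mobius_of [OF det] mobius_of [OF assms(2)] by simp
qed

lemma mobius_mult_upper: "Im z > 0 \<Longrightarrow> mobius (A * B) z = mobius A (mobius B z)"
  by (metis denom_nonzero mobius_mult psl2z_exhaust)

lemma mobius_upper: "Im z > 0 \<Longrightarrow> Im (mobius A z) > 0"
  by (metis Im_mobius denom_nonzero divide_pos_pos psl2z_exhaust zero_less_norm_iff zero_less_power)

lemma mobius_one: "mobius 1 z = z"
  by (simp add: one_psl2z_eq mobius_of)

lemma fund_domD: "z \<in> fund_dom \<Longrightarrow> Im z > 0 \<and> cmod z \<ge> 1 \<and> \<bar>Re z\<bar> \<le> 1 / 2"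
  by (simp add: fund_dom_def)

lemma tile_one: "tile 1 = fund_dom"
  by (simp add: tile_def mobius_one)

lemma tile_mult: "tile (A * B) = mobius A ` tile B"
  unfolding tile_def image_image by (intro image_cong) (auto simp: mobius_mult_upper fund_domD)

text \<open>On the fundamental domain \<open>cmod z \<ge> 1\<close> and \<open>2 * \<bar>Re z\<bar> \<le> 1\<close>, so the square of
  \<open>cmod (c * z + d)\<close> is bounded below by a norm form of the Eisenstein integers. That this bound is
  an integer is what makes the reduction theory work.\<close>

lemma fund_dom_denom:
  fixes c d :: int
  assumes "z \<in> fund_dom"
  shows "(cmod (of_int c * z + of_int d))\<^sup>2 = (of_int c)\<^sup>2 * (cmod z)\<^sup>2 + 2 * of_int c * of_int d * Re z + (of_int d)\<^sup>2"
    and "(cmod (of_int c * z + of_int d))\<^sup>2 \<ge> of_int (c\<^sup>2 - \<bar>c * d\<bar> + d\<^sup>2)"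
proof -
  show eq: "(cmod (of_int c * z + of_int d))\<^sup>2 = (of_int c)\<^sup>2 * (cmod z)\<^sup>2 + 2 * of_int c * of_int d * Re z + (of_int d)\<^sup>2"
    unfolding cmod_power2 by (simp add: power2_eq_square algebra_simps)
  have "1 \<le> (cmod z)\<^sup>2" using fund_domD [OF assms] by simp
  then have "(of_int c)\<^sup>2 * 1 \<le> (of_int c)\<^sup>2 * (cmod z)\<^sup>2" by (intro mult_left_mono) auto
  moreover have "\<bar>2 * of_int c * of_int d * Re z\<bar> = 2 * \<bar>of_int (c * d)\<bar> * \<bar>Re z\<bar>"
    by (simp add: abs_mult)
  then have "\<bar>2 * of_int c * of_int d * Re z\<bar> \<le> 2 * \<bar>of_int (c * d)\<bar> * (1 / 2)"
    using mult_left_mono [of "\<bar>Re z\<bar>" "1 / 2" "2 * \<bar>of_int (c * d)\<bar>"] fund_domD [OF assms] by simp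
  ultimately show "(cmod (of_int c * z + of_int d))\<^sup>2 \<ge> of_int (c\<^sup>2 - \<bar>c * d\<bar> + d\<^sup>2)"
    unfolding eq by simp
qed

lemma eisenstein_norm_le_1:
  fixes c d :: int
  assumes "c\<^sup>2 - \<bar>c * d\<bar> + d\<^sup>2 \<le> 1"
  shows "\<bar>c\<bar> \<le> 1 \<and> \<bar>d\<bar> \<le> 1"
proof -
  define p q where "p = \<bar>c\<bar>" and "q = \<bar>d\<bar>"
  have pq: "p \<ge> 0" "q \<ge> 0" "p * p - p * q + q * q \<le> 1"
    using assms by (auto simp: p_def q_def abs_mult power2_eq_square)
  have aux: "p \<le> 1" if "p \<ge> 0" "q \<ge> 0" "p * p - p * q + q * q \<le> 1" for p q :: int
  proof (rule ccontr)
    assume "\<not> p \<le> 1"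
    then have "p * p \<ge> 2 * 2" by (intro mult_mono) auto
    moreover have "4 * (p * p - p * q + q * q) = 3 * (p * p) + (p - 2 * q) * (p - 2 * q)"
      by algebra
    moreover have "(p - 2 * q) * (p - 2 * q) \<ge> 0" by simp
    ultimately have "3 * (p * p) \<le> 4 * (p * p - p * q + q * q)" by linarith
    also have "\<dots> \<le> 4 * 1" using that(3) by (intro mult_left_mono) auto
    finally show False using \<open>p * p \<ge> 2 * 2\<close> by simp
  qed
  have "p \<le> 1" "q \<le> 1"
    using aux [OF pq] aux [of q p] pq by (auto simp: mult.commute)
  then show ?thesis by (simp add: p_def q_def)
qed

text \<open>The reduction theory of the modular group. Replacing \<open>M\<close> by its inverse if necessary, the
  imaginary part does not decrease, so that \<open>cmod (c * z + d) \<le> 1\<close>. The integer lower bound for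
  this form then leaves only translations and the case of equality, in which \<open>z\<close> and its image have
  the same height and the argument also applies to the inverse.\<close>

lemma fund_dom_meets_image:
  assumes "z \<in> fund_dom" "mobius M z \<in> fund_dom"
  shows "tr_sq M \<le> 3 \<or> M = 1"
proof -
  have main: "tr_sq (psl2z_of a b c d) \<le> 3 \<or> psl2z_of a b c d = 1"
    if z: "z \<in> fund_dom" and w: "w \<in> fund_dom" and det: "a * d - b * c = 1"
      and eq: "w = mobius (psl2z_of a b c d) z" and le: "Im z \<le> Im w"
    for z w a b c d
  proof -
    let ?u = "of_int c * z + of_int d :: complex"
    have Im0: "Im z > 0" using fund_domD [OF z] by simp
    have u0: "?u \<noteq> 0" by (rule denom_nonzero [OF det Im0])
    have "Im z * (cmod ?u)\<^sup>2 \<le> Im z"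
      using le u0 unfolding eq Im_mobius [OF det] by (simp add: field_simps)
    then have u1: "(cmod ?u)\<^sup>2 \<le> 1" using Im0 by simp
    have cd: "c\<^sup>2 - \<bar>c * d\<bar> + d\<^sup>2 \<le> 1"
      using fund_dom_denom(2) [OF z, of c d] u1 by linarith
    then have cd1: "\<bar>c\<bar> \<le> 1" "\<bar>d\<bar> \<le> 1" using eisenstein_norm_le_1 by auto
    have weq: "w = (of_int a * z + of_int b) / ?u" using eq mobius_of [OF det] by simp
    show ?thesis
    proof (cases "c = 0")
      case True
      then have ad: "a = d \<and> \<bar>d\<bar> = 1" using det by (auto simp: zmult_eq_1_iff)
      have "\<bar>b\<bar> \<le> 1"
      proof -
        have "w = z + of_int (a * b)" using weq ad True by (auto simp: abs_if split: if_splits)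
        then have "Re w = Re z + real_of_int (a * b)" by simp
        then have "\<bar>real_of_int (a * b)\<bar> \<le> 1"
          using fund_domD [OF z] fund_domD [OF w] by linarith
        then show ?thesis using ad by (simp add: abs_mult flip: of_int_abs)
      qed
      then have "b\<^sup>2 \<le> 1" by (simp add: abs_square_le_1)
      moreover have "a\<^sup>2 = 1" "d\<^sup>2 = 1" using ad by (auto simp: power2_eq_1_iff abs_if split: if_splits)
      ultimately show ?thesis using det True by (simp add: tr_sq_of)
    next
      case False
      then have c2: "c\<^sup>2 = 1" and c1: "\<bar>c\<bar> = 1" using cd1 by (auto simp: power2_eq_1_iff)
      have "d = - 1 \<or> d = 0 \<or> d = 1" using cd1 by linarith
      then have "c\<^sup>2 - \<bar>c * d\<bar> + d\<^sup>2 \<ge> 1" using c1 c2 by (auto simp: abs_mult)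
      then have u2: "(cmod ?u)\<^sup>2 = 1"
        using fund_dom_denom(2) [OF z, of c d] u1 by linarith
      then have uc: "?u * cnj ?u = 1" by (simp only: complex_norm_square [symmetric] of_real_1)
      \<comment> \<open>On the unit circle inversion is conjugation, so the real part of \<open>w\<close> is explicit.\<close>
      have "of_int c * w = of_int a - cnj ?u"
      proof -
        have "of_int c * w * ?u = of_int c * (of_int a * z + of_int b)" using weq u0 by simp
        also have "\<dots> = of_int a * ?u - of_int (a * d - b * c)" by (simp add: algebra_simps)
        also have "\<dots> = (of_int a - cnj ?u) * ?u" using det uc by (simp add: algebra_simps)
        finally show ?thesis using u0 by simp
      qed
      then have wu: "of_int c * w - of_int a = - cnj ?u" by simp
      have "real_of_int c * Re w = of_int a - of_int c * Re z - of_int d"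
        using arg_cong [OF wu, of Re] by simp
      then have "real_of_int (a - d) = of_int c * (Re w + Re z)" by (simp add: algebra_simps)
      then have "\<bar>real_of_int (a - d)\<bar> = \<bar>Re w + Re z\<bar>"
        using c1 by (simp add: abs_mult flip: of_int_abs)
      then have "\<bar>real_of_int (a - d)\<bar> \<le> 1"
        using fund_domD [OF z] fund_domD [OF w] by linarith
      then have "\<bar>a - d\<bar> \<le> 1" by linarith
      have "(cmod (of_int c * w + of_int (- a)))\<^sup>2 = 1"
        using wu u2 by (simp del: complex_cnj_add)
      then have "c\<^sup>2 - \<bar>c * (- a)\<bar> + (- a)\<^sup>2 \<le> 1"
        using fund_dom_denom(2) [OF w, of c "- a"] by linarith
      then have "\<bar>a\<bar> \<le> 1" using eisenstein_norm_le_1 [of c "- a"] by simp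
      have "a = -1 \<or> a = 0 \<or> a = 1" "d = -1 \<or> d = 0 \<or> d = 1"
        using \<open>\<bar>a\<bar> \<le> 1\<close> cd1 by linarith+
      then have small: "a\<^sup>2 + (a * d - 1)\<^sup>2 + d\<^sup>2 \<le> 2"
        using \<open>\<bar>a - d\<bar> \<le> 1\<close> by auto
      have "b\<^sup>2 = (b * c)\<^sup>2" using c2 by (simp add: power_mult_distrib)
      also have "b * c = a * d - 1" using det by simp
      finally have "a\<^sup>2 + b\<^sup>2 + c\<^sup>2 + d\<^sup>2 \<le> 3" using small c2 by linarith
      then show ?thesis by (simp add: tr_sq_of [OF det])
    qed
  qed
  obtain a b c d where M: "M = psl2z_of a b c d" and det: "a * d - b * c = 1"
    by (rule psl2z_exhaust)
  show ?thesis
  proof (cases "Im z \<le> Im (mobius M z)")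
    case True
    then show ?thesis using main [OF assms det] by (simp add: M)
  next
    case False
    obtain N where N: "M * N = 1" "N * M = 1" "tr_sq N = tr_sq M" using psl2z_inverse_ex by blast
    obtain p q r s where N': "N = psl2z_of p q r s" and det': "p * s - q * r = 1"
      by (rule psl2z_exhaust)
    have "mobius N (mobius M z) = z"
      using N(2) assms(1) by (metis fund_domD mobius_mult_upper mobius_one)
    then have "tr_sq N \<le> 3 \<or> N = 1"
      using main [OF assms(2,1) det'] False by (simp add: N')
    then show ?thesis using N by auto
  qed
qed

lemma tile_eq_fund_dom_iff: "tile M = fund_dom \<longleftrightarrow> M = 1"
proof
  assume *: "tile M = fund_dom"
  obtain a b c d where M: "M = psl2z_of a b c d" and det: "a * d - b * c = 1"
    by (rule psl2z_exhaust)
  \<comment> \<open>The point \<open>2 * \<i>\<close> is moved out of the fundamental domain by every non-identity element.\<close>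
  define w where "w = mobius M (2 * \<i>)"
  have "2 * \<i> \<in> fund_dom" by (simp add: fund_dom_def norm_mult)
  then have w: "w \<in> fund_dom" using * unfolding w_def tile_def by blast
  have "cmod (of_int c * (2 * \<i>) + of_int d) ^ 2 = 4 * (real_of_int c)\<^sup>2 + (real_of_int d)\<^sup>2"
    by (simp add: cmod_power2 power_mult_distrib)
  then have Imw: "Im w = 2 / (4 * (real_of_int c)\<^sup>2 + (real_of_int d)\<^sup>2)"
    by (simp add: w_def M Im_mobius [OF det])
  have "c = 0"
  proof (rule ccontr)
    assume "c \<noteq> 0"
    then have "c\<^sup>2 \<ge> 1" by (simp add: int_one_le_iff_zero_less)
    then have "(real_of_int c)\<^sup>2 \<ge> 1" by (metis of_int_1_le_iff of_int_power)
    then have "4 * (real_of_int c)\<^sup>2 + (real_of_int d)\<^sup>2 \<ge> 4" by (simp add: add_increasing2)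
    then have "Im w \<le> 1 / 2" by (simp add: Imw field_simps)
    moreover have "Im w > 0" using fund_domD [OF w] by simp
    ultimately have "(Im w)\<^sup>2 \<le> (1 / 2)\<^sup>2" by (intro power_mono) auto
    moreover have "\<bar>Re w\<bar>\<^sup>2 \<le> (1 / 2)\<^sup>2" using fund_domD [OF w] by (intro power_mono) auto
    moreover have "1 \<le> (cmod w)\<^sup>2" using fund_domD [OF w] by simp
    ultimately show False unfolding cmod_power2 by (simp add: power2_eq_square)
  qed
  then have ad: "a = d \<and> \<bar>d\<bar> = 1" using det by (auto simp: zmult_eq_1_iff)
  have "w = 2 * \<i> + of_int (a * b)"
    unfolding w_def M mobius_of [OF det] using ad \<open>c = 0\<close> by (auto simp: abs_if split: if_splits)
  then have "\<bar>real_of_int (a * b)\<bar> \<le> 1 / 2" using fund_domD [OF w] by auto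
  then have "a * b = 0" by linarith
  then show "M = 1"
    using ad \<open>c = 0\<close> det by (auto simp: M one_psl2z_eq psl2z_of_eq_iff abs_if split: if_splits)
qed (simp add: tile_one)

lemma tile_eq_iff: "tile A = tile B \<longleftrightarrow> A = B"
proof
  assume *: "tile A = tile B"
  obtain C where C: "C * A = 1" "A * C = 1" using psl2z_inverse_ex by blast
  have "tile (C * B) = tile (C * A)" by (simp add: tile_mult *)
  then have "C * B = 1" by (simp add: C tile_one tile_eq_fund_dom_iff)
  then show "A = B" by (metis C mult.assoc mult_1_left mult_1_right)
qed simp

text \<open>The two corners of the fundamental domain, the primitive third and sixth roots of unity in the
  upper half-plane, witness that each step yields a neighbour.\<close>

lemma fund_dom_meets_step:
  assumes "s \<in> steps"
  shows "\<exists>z\<in>fund_dom. mobius s z \<in> fund_dom"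
proof -
  define r where "r = Complex (1 / 2) (sqrt 3 / 2)"
  define r' where "r' = Complex (- 1 / 2) (sqrt 3 / 2)"
  have cm: "cmod r = 1" "cmod r' = 1"
    by (simp_all add: r_def r'_def cmod_def power_divide)
  have in_dom: "r \<in> fund_dom" "r' \<in> fund_dom"
    unfolding fund_dom_def mem_Collect_eq cm by (simp_all add: r_def r'_def)
  have nz: "r \<noteq> 0" "r' \<noteq> 0" "r' + 1 \<noteq> 0" "1 - r \<noteq> 0"
    by (auto simp: r_def r'_def complex_eq_iff)
  have eqs: "r' + 1 = r" "r - 1 = r'" "r' * r = - 1" "r * r = r - 1" "r' * r' = - r' - 1"
      "r * (r' + 1) = r'" "r' * (1 - r) = r" "r' * (r' + 1) = - 1" "r * (1 - r) = 1"
    by (simp_all add: r_def r'_def complex_eq_iff)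
  have div: "mobius (psl2z_of a b c d) z = w"
    if "a * d - b * c = 1" "of_int c * z + of_int d \<noteq> 0"
      "of_int a * z + of_int b = w * (of_int c * z + of_int d)" for a b c d z w
    unfolding mobius_of [OF that(1)] nonzero_divide_eq_eq [OF that(2)] by (rule that(3))
  from assms show ?thesis
    unfolding steps_eq
  proof (elim insertE emptyE)
    assume s: "s = psl2z_of 0 (-1) 1 0"
    have "mobius s r = r'"
      unfolding s by (rule div) (use nz(1) eqs(3) in simp_all)
    then show ?thesis using in_dom by (intro bexI [of _ r]) simp_all
  next
    assume s: "s = psl2z_of 1 1 0 1"
    have "mobius s r' = r"
      unfolding s by (rule div) (use eqs(1) in simp_all)
    then show ?thesis using in_dom by (intro bexI [of _ r']) simp_all
  next
    assume s: "s = psl2z_of 1 (-1) 0 1"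
    have "mobius s r = r'"
      unfolding s by (rule div) (use eqs(2) in simp_all)
    then show ?thesis using in_dom by (intro bexI [of _ r]) simp_all
  next
    assume s: "s = psl2z_of 1 (-1) 1 0"
    have "mobius s r = r"
      unfolding s by (rule div) (use nz(1) eqs(4) in simp_all)
    then show ?thesis using in_dom by (intro bexI [of _ r]) simp_all
  next
    assume s: "s = psl2z_of (-1) (-1) 1 0"
    have "mobius s r' = r'"
      unfolding s by (rule div) (use nz(2) eqs(5) in simp_all)
    then show ?thesis using in_dom by (intro bexI [of _ r']) simp_all
  next
    assume s: "s = psl2z_of 1 0 1 1"
    have "mobius s r' = r"
      unfolding s by (rule div) (use nz(3) eqs(6) in simp_all)
    then show ?thesis using in_dom by (intro bexI [of _ r']) simp_all
  next
    assume s: "s = psl2z_of 1 0 (-1) 1"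
    have "mobius s r = r'"
      unfolding s by (rule div) (use nz(4) eqs(7) in simp_all)
    then show ?thesis using in_dom by (intro bexI [of _ r]) simp_all
  next
    assume s: "s = psl2z_of 0 (-1) 1 1"
    have "mobius s r' = r'"
      unfolding s by (rule div) (use nz(3) eqs(8) in simp_all)
    then show ?thesis using in_dom by (intro bexI [of _ r']) simp_all
  next
    assume s: "s = psl2z_of 0 1 (-1) 1"
    have "mobius s r = r"
      unfolding s by (rule div) (use nz(4) eqs(9) in simp_all)
    then show ?thesis using in_dom by (intro bexI [of _ r]) simp_all
  qed
qed

lemma tile_adj_iff: "tile_adj (tile A) w \<longleftrightarrow> (\<exists>s\<in>steps. w = tile (A * s))"
proof
  assume "tile_adj (tile A) w"
  then obtain B where w: "w = tile B" and ne: "A \<noteq> B" and meet: "tile A \<inter> tile B \<noteq> {}"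
    by (auto simp: tile_adj_def)
  obtain C where C: "C * A = 1" "A * C = 1" using psl2z_inverse_ex by blast
  from meet obtain x y where xy: "x \<in> fund_dom" "y \<in> fund_dom" "mobius A x = mobius B y"
    by (auto simp: tile_def)
  then have "mobius (C * B) y = mobius (C * A) x" by (simp add: mobius_mult_upper fund_domD)
  then have "mobius (C * B) y = x" by (simp add: C mobius_one)
  then have "tr_sq (C * B) \<le> 3 \<or> C * B = 1" using fund_dom_meets_image xy by metis
  moreover have AB: "A * (C * B) = B" by (metis C(2) mult.assoc mult_1_left)
  then have "C * B \<noteq> 1" using ne by auto
  ultimately have "C * B \<in> steps" by (simp add: steps_def)
  with AB w show "\<exists>s\<in>steps. w = tile (A * s)" by metis
next
  assume "\<exists>s\<in>steps. w = tile (A * s)"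
  then obtain s where s: "s \<in> steps" and w: "w = tile (A * s)" by blast
  have "A * s \<noteq> A" using s psl2z_mult_left_cancel [of A s 1] by (auto simp: steps_def)
  moreover obtain z where z: "z \<in> fund_dom" "mobius s z \<in> fund_dom"
    using fund_dom_meets_step [OF s] by blast
  then have "mobius A (mobius s z) \<in> tile A \<inter> w"
    unfolding w tile_mult by (auto simp: tile_def)
  ultimately show "tile_adj (tile A) w" by (auto simp: tile_adj_def w tile_eq_iff)
qed

lemma card_tile_adj: "card {w. tile_adj (tile A) w} = 9"
proof -
  have "{w. tile_adj (tile A) w} = (\<lambda>s. tile (A * s)) ` steps" by (auto simp: tile_adj_iff)
  moreover have "inj_on (\<lambda>s. tile (A * s)) steps"
    by (auto simp: inj_on_def tile_eq_iff psl2z_mult_left_cancel)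
  ultimately show ?thesis by (simp add: card_image card_steps)
qed

section \<open>The question mark function as a fixed point\<close>

text \<open>The inverse of the branch \<open>w \<mapsto> w / (1 + w)\<close>, continued linearly beyond \<open>1 / 2\<close>, where only the
  fact that its values are at least 1 matters. Since distribution functions of laws on the unit
  interval are constant there, both branches of the functional equation become a single formula
  without case distinctions. The other branch \<open>w \<mapsto> 1 / (1 + w)\<close> is inverted by \<open>\<lambda>x. half_fold (1 - x)\<close>.\<close>

definition half_fold :: "real \<Rightarrow> real" where
  "half_fold x = x / max (1 / 2) (1 - x)"

lemma mono_half_fold: "mono half_fold"
proof (rule monoI)
  fix x y :: real assume "x \<le> y"
  show "half_fold x \<le> half_fold y"
  proof (cases "x \<ge> 0")
    case True
    then show ?thesis unfolding half_fold_def using \<open>x \<le> y\<close> by (intro frac_le) auto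
  next
    case False
    show ?thesis
    proof (cases "y \<ge> 0")
      case True
      have "half_fold x \<le> 0" "half_fold y \<ge> 0" using False True
        by (auto simp: half_fold_def divide_nonpos_pos less_max_iff_disj)
      then show ?thesis by simp
    next
      case y: False
      with False \<open>x \<le> y\<close> show ?thesis
        by (simp add: half_fold_def max_def field_simps)
    qed
  qed
qed

lemma continuous_half_fold: "continuous_on A half_fold"
  unfolding half_fold_def by (intro continuous_intros) (auto simp: max_def)

lemma half_fold_nonpos: "x \<le> 0 \<Longrightarrow> half_fold x \<le> 0"
  by (simp add: half_fold_def divide_nonpos_pos less_max_iff_disj)

lemma half_fold_ge_1: "x \<ge> 1 / 2 \<Longrightarrow> half_fold x \<ge> 1"
  by (simp add: half_fold_def max_def)

lemma half_fold_left: "x \<le> 1 / 2 \<Longrightarrow> half_fold x = x / (1 - x)"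
  by (simp add: half_fold_def max_def)

text \<open>The right-hand side of the functional equation preserves the closed set of continuous
  distribution functions of laws on the unit interval. At each point one of its two terms is
  constant on this set, so it contracts uniform distances by \<open>1 / 2\<close>, and Banach's theorem gives a
  fixed point. Continuity of the fixed point means that the resulting law has no atoms.\<close>

lemma minkowski_fixpoint_ex:
  "\<exists>F :: real \<Rightarrow> real. mono F \<and> continuous_on UNIV F \<and> (\<forall>x\<le>0. F x = 0) \<and> (\<forall>x\<ge>1. F x = 1) \<and>
     (\<forall>x. F x = F (half_fold x) / 2 + (1 - F (half_fold (1 - x))) / 2)"
proof -
  define S where "S = {g :: real \<Rightarrow>\<^sub>C real. mono (apply_bcontfun g) \<and>
     (\<forall>x\<le>0. apply_bcontfun g x = 0) \<and> (\<forall>x\<ge>1. apply_bcontfun g x = 1)}"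
  define Phi where "Phi = (\<lambda>g x. g (half_fold x) / 2 + (1 - g (half_fold (1 - x))) / 2 :: real)"
  have bounds: "\<bar>g x\<bar> \<le> 1" if "mono g" "\<forall>x\<le>0. g x = 0" "\<forall>x\<ge>1. g x = 1" for g :: "real \<Rightarrow> real" and x
    using monoD [OF that(1), of 0 x] monoD [OF that(1), of x 1] that(2,3)
    by (cases "x \<le> 0"; cases "x \<ge> 1") auto
  have mkS: "g \<in> bcontfun \<and> Bcontfun g \<in> S"
    if "mono g" "\<forall>x\<le>0. g x = 0" "\<forall>x\<ge>1. g x = 1" "continuous_on UNIV g" for g
  proof -
    have "g \<in> bcontfun"
      by (rule bcontfun_normI [where b = 1]) (use that bounds in auto)
    with that show ?thesis by (simp add: S_def Bcontfun_inverse)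
  qed
  have PhiS: "mono (Phi g) \<and> (\<forall>x\<le>0. Phi g x = 0) \<and> (\<forall>x\<ge>1. Phi g x = 1) \<and> continuous_on UNIV (Phi g)"
    if g: "mono g" "\<forall>x\<le>0. g x = 0" "\<forall>x\<ge>1. g x = 1" "continuous_on UNIV g" for g
  proof (intro conjI allI impI)
    show "mono (Phi g)"
    proof (rule monoI)
      fix x y :: real assume "x \<le> y"
      have "g (half_fold x) \<le> g (half_fold y)" "g (half_fold (1 - y)) \<le> g (half_fold (1 - x))"
        using \<open>x \<le> y\<close> by (auto intro!: monoD [OF g(1)] monoD [OF mono_half_fold])
      then show "Phi g x \<le> Phi g y" unfolding Phi_def by argo
    qed
    show "continuous_on UNIV (Phi g)"
      unfolding Phi_def
      by (intro continuous_intros continuous_on_compose2 [OF g(4)]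
            continuous_on_compose2 [OF continuous_half_fold]) auto
  next
    fix x :: real assume "x \<le> 0"
    then show "Phi g x = 0"
      using g(2,3) half_fold_nonpos [of x] half_fold_ge_1 [of "1 - x"] by (simp add: Phi_def)
  next
    fix x :: real assume "x \<ge> 1"
    then show "Phi g x = 1"
      using g(2,3) half_fold_nonpos [of "1 - x"] half_fold_ge_1 [of x] by (simp add: Phi_def)
  qed
  have S_D: "mono (apply_bcontfun g)" "\<forall>x\<le>0. apply_bcontfun g x = 0"
      "\<forall>x\<ge>1. apply_bcontfun g x = 1" "continuous_on UNIV (apply_bcontfun g)" if "g \<in> S" for g
    using that by (auto simp: S_def)
  define T where "T = (\<lambda>g. Bcontfun (Phi (apply_bcontfun g)))"
  have T: "apply_bcontfun (T g) = Phi (apply_bcontfun g)" "T g \<in> S" if "g \<in> S" for g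
  proof -
    note * = PhiS [OF S_D [OF that]]
    then have "Phi (apply_bcontfun g) \<in> bcontfun \<and> Bcontfun (Phi (apply_bcontfun g)) \<in> S"
      by (intro mkS) auto
    then show "apply_bcontfun (T g) = Phi (apply_bcontfun g)" "T g \<in> S"
      by (auto simp: T_def Bcontfun_inverse)
  qed
  have lim: "(\<lambda>n. apply_bcontfun (g n) x) \<longlonglongrightarrow> apply_bcontfun l x"
    if "g \<longlonglongrightarrow> l" for g :: "nat \<Rightarrow> real \<Rightarrow>\<^sub>C real" and l x
  proof (rule metric_tendsto_imp_tendsto [OF that])
    show "\<forall>\<^sub>F n in sequentially. dist (apply_bcontfun (g n) x) (apply_bcontfun l x) \<le> dist (g n) l"
      by (simp add: dist_bounded)
  qed
  have closedS: "closed S"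
    unfolding closed_sequential_limits
  proof (intro allI impI, elim conjE)
    fix g :: "nat \<Rightarrow> real \<Rightarrow>\<^sub>C real" and l assume g: "\<forall>n. g n \<in> S" and l: "g \<longlonglongrightarrow> l"
    have "mono (apply_bcontfun l)"
    proof (rule monoI)
      fix x y :: real assume "x \<le> y"
      show "apply_bcontfun l x \<le> apply_bcontfun l y"
        by (rule LIMSEQ_le [OF lim [OF l] lim [OF l]])
           (intro exI [of _ 0] allI impI monoD [OF S_D(1)]; use g \<open>x \<le> y\<close> in simp)
    qed
    moreover have "apply_bcontfun l x = 0" if "x \<le> 0" for x
      using lim [OF l, of x] g that LIMSEQ_unique [OF lim [OF l, of x], of 0]
      by (auto simp: S_def)
    moreover have "apply_bcontfun l x = 1" if "x \<ge> 1" for x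
      using lim [OF l, of x] g that LIMSEQ_unique [OF lim [OF l, of x], of 1]
      by (auto simp: S_def)
    ultimately show "l \<in> S" by (simp add: S_def)
  qed
  have "\<exists>!g\<in>S. T g = g"
  proof (rule Banach_fix [OF complete_eq_closed [THEN iffD2, OF closedS]])
    have "mono (\<lambda>x. max 0 (min 1 x) :: real)" by (auto intro!: monoI)
    then have "Bcontfun (\<lambda>x. max 0 (min 1 x)) \<in> S"
      by (intro mkS [THEN conjunct2]) (auto intro!: continuous_intros)
    then show "S \<noteq> {}" by auto
    show "T ` S \<subseteq> S" using T(2) by auto
    fix g h assume gh: "g \<in> S" "h \<in> S"
    show "dist (T g) (T h) \<le> 1 / 2 * dist g h"
    proof (rule dist_bound)
      fix x
      let ?g = "apply_bcontfun g" and ?h = "apply_bcontfun h"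
      have "dist (Phi ?g x) (Phi ?h x) \<le> dist g h / 2"
      proof (cases "x \<le> 1 / 2")
        case True
        then have "half_fold (1 - x) \<ge> 1" by (intro half_fold_ge_1) auto
        then have "dist (Phi ?g x) (Phi ?h x) = dist (?g (half_fold x)) (?h (half_fold x)) / 2"
          using S_D(3) [OF gh(1)] S_D(3) [OF gh(2)]
          by (simp add: Phi_def dist_real_def flip: diff_divide_distrib)
        then show ?thesis using dist_bounded [of g "half_fold x" h] by simp
      next
        case False
        then have "half_fold x \<ge> 1" by (intro half_fold_ge_1) auto
        then have "dist (Phi ?g x) (Phi ?h x) =
            dist (?g (half_fold (1 - x))) (?h (half_fold (1 - x))) / 2"
          using S_D(3) [OF gh(1)] S_D(3) [OF gh(2)]
          by (simp add: Phi_def dist_real_def abs_minus_commute flip: diff_divide_distrib)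
        then show ?thesis using dist_bounded [of g "half_fold (1 - x)" h] by simp
      qed
      then show "dist (apply_bcontfun (T g) x) (apply_bcontfun (T h) x) \<le> 1 / 2 * dist g h"
        using T(1) gh by simp
    qed
  qed (auto)
  then obtain g where "g \<in> S" "T g = g" by blast
  then have "apply_bcontfun g = Phi (apply_bcontfun g)" using T(1) by metis
  with S_D [OF \<open>g \<in> S\<close>] show ?thesis
    unfolding Phi_def by (intro exI [of _ "apply_bcontfun g"]) (metis)
qed

definition minkowski_cdf :: "real \<Rightarrow> real" where
  "minkowski_cdf = (SOME F. mono F \<and> continuous_on UNIV F \<and> (\<forall>x\<le>0. F x = 0) \<and>
     (\<forall>x\<ge>1. F x = 1) \<and> (\<forall>x. F x = F (half_fold x) / 2 + (1 - F (half_fold (1 - x))) / 2))"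

lemma
  shows mono_minkowski_cdf: "mono minkowski_cdf"
    and continuous_minkowski_cdf: "continuous_on UNIV minkowski_cdf"
    and minkowski_cdf_nonpos: "x \<le> 0 \<Longrightarrow> minkowski_cdf x = 0"
    and minkowski_cdf_ge_1: "x \<ge> 1 \<Longrightarrow> minkowski_cdf x = 1"
    and minkowski_cdf_fixpoint: "minkowski_cdf x =
      minkowski_cdf (half_fold x) / 2 + (1 - minkowski_cdf (half_fold (1 - x))) / 2"
  using someI_ex [OF minkowski_fixpoint_ex] unfolding minkowski_cdf_def [symmetric] by blast+

lemma minkowski_cdf_bounds: "0 \<le> minkowski_cdf x" "minkowski_cdf x \<le> 1"
  using monoD [OF mono_minkowski_cdf, of 0 x] monoD [OF mono_minkowski_cdf, of x 1]
    minkowski_cdf_nonpos [of x] minkowski_cdf_nonpos [of 0]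
    minkowski_cdf_ge_1 [of x] minkowski_cdf_ge_1 [of 1]
  by (cases "x \<le> 0"; cases "x \<ge> 1"; simp)+

text \<open>One continued fraction digit. The right branch of the functional equation gives digit 1, and each
  use of the left branch increases the digit by 1 and halves the value.\<close>

lemma minkowski_cdf_cf:
  assumes "x > 0" "x < 1" "k > 0"
  shows "minkowski_cdf (1 / (real k + x)) = (1 / 2) ^ k * (2 - minkowski_cdf x)"
  using \<open>k > 0\<close>
proof (induction k rule: nat_induct_non_zero)
  case 1
  have "half_fold (1 / (1 + x)) \<ge> 1"
    using assms by (intro half_fold_ge_1) (simp add: field_simps)
  moreover have "half_fold (1 - 1 / (1 + x)) = x"
    using assms by (subst half_fold_left) (simp_all add: field_simps)
  ultimately show ?case
    by (subst minkowski_cdf_fixpoint) (simp add: minkowski_cdf_ge_1)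
next
  case (Suc n)
  have "half_fold (1 - 1 / (real (Suc n) + x)) \<ge> 1"
    using assms Suc.hyps by (intro half_fold_ge_1) (simp add: field_simps)
  moreover have "half_fold (1 / (real (Suc n) + x)) = 1 / (real n + x)"
    using assms Suc.hyps by (subst half_fold_left) (simp_all add: field_simps)
  ultimately show ?case
    by (subst minkowski_cdf_fixpoint) (simp add: minkowski_cdf_ge_1 Suc.IH)
qed

lemma cf_convergent_bounds:
  assumes "\<And>i. k i > 0"
  shows "0 \<le> cf_convergent k n" "cf_convergent k n \<le> 1"
  using assms
proof (induction n arbitrary: k)
  case (Suc n)
  {
    case 1
    show ?case using Suc(1)[of "\<lambda>i. k (Suc i)"] 1 by simp
  next
    case 2
    have "k 0 \<ge> 1" using 2[of 0] by simp
    then have "real (k 0) \<ge> 1" by simp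
    then show ?case using Suc(1)[of "\<lambda>i. k (Suc i)"] 2 by (simp add: field_simps)
  }
qed auto

text \<open>The first digit of an expansion is forced, and the Gauss map strips it. Iterating this gives
  uniqueness.\<close>

lemma cf_expansion_shift:
  assumes "cf_expansion k x" "x \<notin> \<rat>"
  shows "cf_expansion (\<lambda>i. k (Suc i)) (1 / x - real (k 0))"
    and "1 / x - real (k 0) \<in> {0<..<1} - \<rat>" "k 0 = nat \<lfloor>1 / x\<rfloor>"
proof -
  let ?k = "\<lambda>i. k (Suc i)" and ?y = "1 / x - real (k 0)"
  have pos: "\<And>i. k i > 0" and lim: "cf_convergent k \<longlonglongrightarrow> x"
    using assms(1) by (auto simp: cf_expansion_def)
  have "x \<noteq> 0" using assms(2) by auto
  have "(\<lambda>n. 1 / cf_convergent k (Suc n) - real (k 0)) \<longlonglongrightarrow> ?y"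
    using \<open>x \<noteq> 0\<close> by (intro tendsto_intros LIMSEQ_Suc [OF lim])
  also have "(\<lambda>n. 1 / cf_convergent k (Suc n) - real (k 0)) = cf_convergent ?k"
    by (simp add: fun_eq_iff)
  finally have lim': "cf_convergent ?k \<longlonglongrightarrow> ?y" .
  then show "cf_expansion ?k ?y" using pos by (simp add: cf_expansion_def)
  have "0 \<le> ?y" "?y \<le> 1"
    using LIMSEQ_le_const [OF lim', of 0] LIMSEQ_le_const2 [OF lim', of 1]
      cf_convergent_bounds [of ?k] pos by auto
  moreover have "?y \<notin> \<rat>"
  proof
    assume "?y \<in> \<rat>"
    then have "1 / (?y + real (k 0)) \<in> \<rat>" by (intro Rats_divide Rats_add) auto
    with assms(2) show False by simp
  qed
  then have "?y \<noteq> 0" "?y \<noteq> 1" by (metis Rats_0, metis Rats_1)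
  ultimately show y: "?y \<in> {0<..<1} - \<rat>" using \<open>?y \<notin> \<rat>\<close> by simp
  then have "\<lfloor>1 / x\<rfloor> = int (k 0)" by (intro floor_unique) auto
  then show "k 0 = nat \<lfloor>1 / x\<rfloor>" by simp
qed

lemma cf_expansion_unique:
  assumes "cf_expansion k x" "cf_expansion l x" "x \<notin> \<rat>"
  shows "k = l"
proof
  fix i show "k i = l i" using assms
  proof (induction i arbitrary: k l x)
    case 0
    then show ?case using cf_expansion_shift(3) by metis
  next
    case (Suc i)
    have "k 0 = l 0" using Suc.prems cf_expansion_shift(3) by metis
    then have "cf_expansion (\<lambda>i. l (Suc i)) (1 / x - real (k 0))"
      using cf_expansion_shift(1) [OF Suc.prems(2,3)] by (simp only:)
    moreover have "1 / x - real (k 0) \<notin> \<rat>"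
      using cf_expansion_shift(2) [OF Suc.prems(1,3)] by blast
    ultimately show ?case
      by (rule Suc.IH [OF cf_expansion_shift(1) [OF Suc.prems(1,3)]])
  qed
qed

text \<open>Iterates of the Gauss map; the floors of their inverses are the partial quotients.\<close>

primrec gauss_iter :: "real \<Rightarrow> nat \<Rightarrow> real" where
  "gauss_iter x 0 = x"
| "gauss_iter x (Suc n) = gauss_iter (1 / x - real (nat \<lfloor>1 / x\<rfloor>)) n"

lemma gauss_step:
  assumes "x \<in> {0<..<1} - \<rat>"
  shows "1 / x - real (nat \<lfloor>1 / x\<rfloor>) \<in> {0<..<1} - \<rat>" "nat \<lfloor>1 / x\<rfloor> > 0"
proof -
  let ?y = "1 / x - real (nat \<lfloor>1 / x\<rfloor>)"
  have "1 / x > 1" using assms by simp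
  then have fl: "\<lfloor>1 / x\<rfloor> \<ge> 1" by linarith
  then show "nat \<lfloor>1 / x\<rfloor> > 0" by simp
  have "?y \<notin> \<rat>"
  proof
    assume "?y \<in> \<rat>"
    then have "1 / (?y + real (nat \<lfloor>1 / x\<rfloor>)) \<in> \<rat>" by (intro Rats_divide Rats_add) auto
    with assms show False by simp
  qed
  then have "?y \<noteq> 0" by (metis Rats_0)
  moreover have "?y \<ge> 0" "?y < 1" using fl by linarith+
  ultimately show "?y \<in> {0<..<1} - \<rat>" using \<open>?y \<notin> \<rat>\<close> by simp
qed

lemma gauss_floor_pos: "x \<in> {0<..<1} - \<rat> \<Longrightarrow> nat \<lfloor>1 / gauss_iter x i\<rfloor> > 0"
proof (induction i arbitrary: x)
  case 0
  then show ?case using gauss_step(2) [OF 0] by (simp only: gauss_iter.simps)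
next
  case (Suc i)
  show ?case using Suc.IH [OF gauss_step(1) [OF Suc.prems]] by (simp only: gauss_iter.simps)
qed

text \<open>A single digit 1 does not contract the error by a fixed factor, but two consecutive digits contract it by the
  factor \<open>1 / 4\<close>. Hence the induction proceeds in steps of two.\<close>

lemma cf_convergent_gauss:
  assumes "x \<in> {0<..<1} - \<rat>"
  shows "\<bar>x - cf_convergent (\<lambda>i. nat \<lfloor>1 / gauss_iter x i\<rfloor>) n\<bar> \<le> 2 * (1 / 2) ^ n"
  using assms
proof (induction n arbitrary: x rule: less_induct)
  case (less n)
  define K where "K = (\<lambda>x i. nat \<lfloor>1 / gauss_iter x i\<rfloor>)"
  define y where "y = 1 / x - real (K x 0)"
  define u where "u = 1 / y - real (K y 0)"
  have y: "y \<in> {0<..<1} - \<rat>" and k0: "K x 0 > 0"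
    using gauss_step [OF less.prems] by (simp_all add: y_def K_def)
  have u: "u \<in> {0<..<1} - \<rat>" and k1: "K y 0 > 0"
    using gauss_step [OF y] by (simp_all add: u_def K_def)
  have Ksuc: "K x (Suc i) = K y i" "K y (Suc i) = K u i" for i
    by (simp_all add: K_def y_def u_def)
  have Kpos: "K v i > 0" if "v \<in> {0<..<1} - \<rat>" for v i
    unfolding K_def by (rule gauss_floor_pos [OF that])
  have xy: "x = 1 / (real (K x 0) + y)" using less.prems by (simp add: y_def)
  have yu: "y = 1 / (real (K y 0) + u)" using y by (simp add: u_def)
  consider "n = 0" | "n = 1" | m where "n = Suc (Suc m)"
    by (metis One_nat_def not0_implies_Suc)
  then show ?case
  proof cases
    case 3
    define c where "c = cf_convergent (K u) m"
    have c0: "c \<ge> 0" unfolding c_def by (intro cf_convergent_bounds Kpos u)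
    define p q where "p = real (K x 0)" and "q = real (K y 0)"
    have pq: "p \<ge> 1" "q \<ge> 1" using k0 k1 by (auto simp: p_def q_def)
    have c: "cf_convergent (K x) n = 1 / (p + 1 / (q + c))"
      by (simp add: 3 Ksuc c_def p_def q_def)
    have "x - 1 / (p + 1 / (q + c)) = (u - c) / ((p * (q + u) + 1) * (p * (q + c) + 1))"
    proof -
      have "x = 1 / (p + 1 / (q + u))" using xy yu by (simp add: p_def q_def)
      moreover have inv: "1 / (p + 1 / a) = a / (p * a + 1)" "p * a + 1 \<noteq> 0"
        if "a > 0" for a :: real
      proof -
        have "p * a > 0" using pq that by simp
        then show "p * a + 1 \<noteq> 0" by linarith
        show "1 / (p + 1 / a) = a / (p * a + 1)" using that by (simp add: divide_simps)
      qed
      moreover have "q + u > 0" "q + c > 0" using pq c0 u by auto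
      ultimately have "x - 1 / (p + 1 / (q + c)) =
          (q + u) / (p * (q + u) + 1) - (q + c) / (p * (q + c) + 1)"
        by metis
      also have "\<dots> = ((q + u) * (p * (q + c) + 1) - (q + c) * (p * (q + u) + 1)) /
            ((p * (q + u) + 1) * (p * (q + c) + 1))"
        using \<open>q + u > 0\<close> \<open>q + c > 0\<close> by (intro diff_frac_eq inv(2))
      also have "(q + u) * (p * (q + c) + 1) - (q + c) * (p * (q + u) + 1) = u - c"
        by (simp add: algebra_simps)
      finally show ?thesis .
    qed
    then have "\<bar>x - cf_convergent (K x) n\<bar> = \<bar>u - c\<bar> / \<bar>(p * (q + u) + 1) * (p * (q + c) + 1)\<bar>"
      by (simp add: c abs_divide)
    also have "\<dots> \<le> (2 * (1 / 2) ^ m) / 4"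
    proof (rule frac_le)
      show "\<bar>u - c\<bar> \<le> 2 * (1 / 2) ^ m"
        unfolding c_def K_def by (rule less.IH [OF _ u]) (simp add: 3)
      have "p * (q + u) \<ge> 1 * 1" "p * (q + c) \<ge> 1 * 1"
        using pq u c0 by (intro mult_mono; simp)+
      then have "(p * (q + u) + 1) * (p * (q + c) + 1) \<ge> 2 * 2"
        by (intro mult_mono) auto
      then show "4 \<le> \<bar>(p * (q + u) + 1) * (p * (q + c) + 1)\<bar>" by linarith
    qed auto
    also have "\<dots> = 2 * (1 / 2) ^ n" by (simp add: 3)
    finally show ?thesis unfolding K_def .
  next
    case 1
    then show ?thesis using less.prems by simp
  next
    case 2
    have "0 \<le> cf_convergent (K x) n" "cf_convergent (K x) n \<le> 1"
      by (intro cf_convergent_bounds Kpos less.prems)+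
    moreover have "0 < x" "x < 1" using less.prems by auto
    ultimately have "\<bar>x - cf_convergent (K x) n\<bar> \<le> 1" by linarith
    then show ?thesis using 2 by (simp add: K_def)
  qed
qed

lemma cf_expansion_ex:
  assumes "x \<in> {0<..<1} - \<rat>"
  shows "\<exists>k. cf_expansion k x"
proof -
  let ?K = "\<lambda>i. nat \<lfloor>1 / gauss_iter x i\<rfloor>"
  have "\<forall>i. ?K i > 0" using gauss_floor_pos [OF assms] by blast
  moreover have "cf_convergent ?K \<longlonglongrightarrow> x"
  proof (rule LIM_zero_cancel, rule Lim_null_comparison)
    have "norm (cf_convergent ?K n - x) \<le> 2 * (1 / 2) ^ n" for n
      using cf_convergent_gauss [OF assms, of n] by (simp only: real_norm_def abs_minus_commute)
    then show "\<forall>\<^sub>F n in sequentially. norm (cf_convergent ?K n - x) \<le> 2 * (1 / 2) ^ n"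
      by (rule always_eventually [OF allI])
    show "(\<lambda>n. 2 * (1 / 2) ^ n :: real) \<longlonglongrightarrow> 0"
      by (intro tendsto_mult_right_zero LIMSEQ_power_zero) simp
  qed
  ultimately have "cf_expansion ?K x" unfolding cf_expansion_def by blast
  then show ?thesis by blast
qed

text \<open>The defining series of the question mark function satisfies the same one-digit recursion as the
  fixed point of the functional equation.\<close>

lemma minkowski_series:
  fixes k :: "nat \<Rightarrow> nat"
  assumes "\<And>i. k i > 0"
  defines "Q \<equiv> \<lambda>k :: nat \<Rightarrow> nat. 2 * (\<Sum>n. (- 1) ^ n * (1 / 2) ^ (\<Sum>j\<le>n. k j)) :: real"
  shows "\<bar>Q k\<bar> \<le> 2" "Q k = (1 / 2) ^ k 0 * (2 - Q (\<lambda>i. k (Suc i)))"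
proof -
  have le: "\<bar>(- 1) ^ n * (1 / 2) ^ (\<Sum>j\<le>n. k j)\<bar> \<le> (1 / 2 :: real) ^ Suc n"
    if "\<And>i. k i > 0" for n and k :: "nat \<Rightarrow> nat"
  proof -
    have "(\<Sum>j\<le>n. 1) \<le> (\<Sum>j\<le>n. k j)" using that by (intro sum_mono) (simp add: Suc_leI)
    then show ?thesis by (simp add: abs_mult power_abs power_decreasing del: power_Suc)
  qed
  have sg: "summable (\<lambda>n. (1 / 2 :: real) ^ Suc n)" by (simp add: summable_geometric)
  have sm: "summable (\<lambda>n. (- 1) ^ n * (1 / 2) ^ (\<Sum>j\<le>n. k j) :: real)"
    if "\<And>i. k i > 0" for k :: "nat \<Rightarrow> nat"
    by (rule summable_comparison_test' [OF sg]) (use le [OF that] in simp)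
  have "norm (\<Sum>n. (- 1) ^ n * (1 / 2) ^ (\<Sum>j\<le>n. k j) :: real) \<le> (\<Sum>n. (1 / 2 :: real) ^ Suc n)"
    by (rule norm_suminf_le [OF _ sg]) (use le [OF assms(1)] in simp)
  also have "\<dots> = 1" using power_half_series sums_unique by metis
  finally show "\<bar>Q k\<bar> \<le> 2" by (simp add: Q_def)
  have *: "(- 1) ^ Suc n * (1 / 2) ^ (\<Sum>j\<le>Suc n. k j) =
      - ((1 / 2) ^ k 0) * ((- 1) ^ n * (1 / 2 :: real) ^ (\<Sum>j\<le>n. k (Suc j)))" for n
    by (subst sum.atMost_Suc_shift) (simp add: power_add)
  have "(\<Sum>n. (- 1) ^ n * (1 / 2) ^ (\<Sum>j\<le>n. k j) :: real) =
      (1 / 2) ^ k 0 + (\<Sum>n. (- 1) ^ Suc n * (1 / 2) ^ (\<Sum>j\<le>Suc n. k j))"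
    using suminf_split_head [OF sm [of k, OF assms(1)]] by simp
  also have "(\<Sum>n. (- 1) ^ Suc n * (1 / 2) ^ (\<Sum>j\<le>Suc n. k j) :: real) =
      - ((1 / 2) ^ k 0) * (\<Sum>n. (- 1) ^ n * (1 / 2) ^ (\<Sum>j\<le>n. k (Suc j)))"
    unfolding * by (rule suminf_mult) (rule sm, rule assms(1))
  finally show "Q k = (1 / 2) ^ k 0 * (2 - Q (\<lambda>i. k (Suc i)))"
    by (simp add: Q_def algebra_simps)
qed

text \<open>Both sides satisfy the one-digit recursion, which multiplies their difference by at most
  \<open>1 / 2\<close>. As the difference is bounded, it vanishes.\<close>

lemma question_mark_irrational_eq:
  assumes "x \<in> {0<..<1} - \<rat>"
  shows "question_mark_irrational x = minkowski_cdf x"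
proof -
  define Q where "Q = (\<lambda>k :: nat \<Rightarrow> nat. 2 * (\<Sum>n. (- 1) ^ n * (1 / 2) ^ (\<Sum>j\<le>n. k j)) :: real)"
  have close: "\<bar>minkowski_cdf x - Q k\<bar> \<le> 3 * (1 / 2) ^ n"
    if "cf_expansion k x" "x \<in> {0<..<1} - \<rat>" for n k x
    using that
  proof (induction n arbitrary: k x)
    case 0
    then have "\<bar>Q k\<bar> \<le> 2" unfolding Q_def by (intro minkowski_series) (simp add: cf_expansion_def)
    then show ?case using minkowski_cdf_bounds [of x] by simp
  next
    case (Suc n)
    let ?y = "1 / x - real (k 0)" and ?k = "\<lambda>i. k (Suc i)"
    have pos: "\<And>i. k i > 0" using Suc.prems by (simp add: cf_expansion_def)
    have y: "cf_expansion ?k ?y" "?y \<in> {0<..<1} - \<rat>"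
      using cf_expansion_shift [OF Suc.prems(1)] Suc.prems(2) by auto
    have "x = 1 / (real (k 0) + ?y)" by simp
    then have "minkowski_cdf x = (1 / 2) ^ k 0 * (2 - minkowski_cdf ?y)"
      using minkowski_cdf_cf [of ?y "k 0"] y(2) pos by auto
    moreover have "Q k = (1 / 2) ^ k 0 * (2 - Q ?k)"
      unfolding Q_def by (rule minkowski_series(2)) (rule pos)
    ultimately have "minkowski_cdf x - Q k = (1 / 2) ^ k 0 * (Q ?k - minkowski_cdf ?y)"
      by (simp add: algebra_simps)
    then have "\<bar>minkowski_cdf x - Q k\<bar> = (1 / 2) ^ k 0 * \<bar>minkowski_cdf ?y - Q ?k\<bar>"
      by (simp add: abs_mult power_abs abs_minus_commute)
    also have "\<dots> \<le> (1 / 2) ^ 1 * (3 * (1 / 2) ^ n)"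
      using pos [of 0] Suc.IH [OF y] by (intro mult_mono power_decreasing) auto
    finally show ?case by simp
  qed
  obtain k where k: "cf_expansion k x" using cf_expansion_ex [OF assms] by blast
  have "(THE k. cf_expansion k x) = k"
    using k cf_expansion_unique assms by (intro the_equality) auto
  then have "question_mark_irrational x = Q k"
    by (simp add: question_mark_irrational_def Q_def)
  moreover have "minkowski_cdf x - Q k = 0"
  proof (rule LIMSEQ_unique [OF tendsto_const])
    show "(\<lambda>n. minkowski_cdf x - Q k) \<longlonglongrightarrow> 0"
    proof (rule Lim_null_comparison)
      show "\<forall>\<^sub>F n in sequentially. norm (minkowski_cdf x - Q k) \<le> 3 * (1 / 2) ^ n"
        using close [OF k assms] by simp
      show "(\<lambda>n. 3 * (1 / 2) ^ n :: real) \<longlonglongrightarrow> 0"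
        by (intro tendsto_mult_right_zero LIMSEQ_power_zero) simp
    qed
  qed
  ultimately show ?thesis by simp
qed

lemma islimpt_irrational:
  fixes x :: real
  assumes "x \<in> {0..1}"
  shows "x islimpt ({0<..<1} - \<rat>)"
proof -
  have "uncountable ({a<..<b} - \<rat>)" if "a < b" for a b :: real
    using that countable_rat uncountable_minus_countable uncountable_open_interval by metis
  then have irr: "\<exists>y. a < y \<and> y < b \<and> y \<notin> \<rat>" if "a < b" for a b :: real
    using that by (metis DiffE countable_empty equals0I greaterThanLessThan_iff)
  show ?thesis
    unfolding islimpt_approachable
  proof (intro allI impI)
    fix e :: real assume "e > 0"
    show "\<exists>x'\<in>{0<..<1} - \<rat>. x' \<noteq> x \<and> dist x' x < e"
    proof (cases "x < 1")
      case True
      then obtain y where "x < y" "y < min 1 (x + e)" "y \<notin> \<rat>"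
        using irr [of x "min 1 (x + e)"] \<open>e > 0\<close> by auto
      then show ?thesis using assms by (intro bexI [of _ y]) (auto simp: dist_real_def)
    next
      case False
      then have "x = 1" using assms by simp
      then obtain y where "max 0 (1 - e) < y" "y < 1" "y \<notin> \<rat>"
        using irr [of "max 0 (1 - e)" 1] \<open>e > 0\<close> by auto
      then show ?thesis using \<open>x = 1\<close> by (intro bexI [of _ y]) (auto simp: dist_real_def)
    qed
  qed
qed

text \<open>At rational points and at the ends of the interval the question mark function is a limit along
  irrational points, which continuity of the fixed point evaluates.\<close>

lemma question_mark_eq:
  assumes "x \<in> {0..1}"
  shows "question_mark x = minkowski_cdf x"
proof (cases "x \<in> {0<..<1} - \<rat>")
  case True
  then show ?thesis by (simp add: question_mark_def question_mark_irrational_eq)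
next
  case False
  have "(minkowski_cdf \<longlongrightarrow> minkowski_cdf x) (at x within ({0<..<1} - \<rat>))"
    using continuous_minkowski_cdf
    by (meson UNIV_I continuous_on_def subset_UNIV tendsto_within_subset)
  then have "(question_mark_irrational \<longlongrightarrow> minkowski_cdf x) (at x within ({0<..<1} - \<rat>))"
    by (rule Lim_transform_within [OF _ zero_less_one]) (simp add: question_mark_irrational_eq)
  moreover have "at x within ({0<..<1} - \<rat>) \<noteq> bot"
    using islimpt_irrational [OF assms] by (simp add: trivial_limit_within)
  ultimately have "Lim (at x within ({0<..<1} - \<rat>)) question_mark_irrational = minkowski_cdf x"
    by (intro tendsto_Lim)
  then show ?thesis unfolding question_mark_def if_not_P [OF False] .
qed

section \<open>The Minkowski measure and its stationarity\<close>

definition sign_pmf :: "real pmf" where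
  "sign_pmf = pmf_of_set {1, - 1}"

lemma pmf_sign: "pmf sign_pmf 1 = 1 / 2" "pmf sign_pmf (- 1) = 1 / 2" "set_pmf sign_pmf = {1, - 1}"
  by (simp_all add: sign_pmf_def)

lemma integral_sign_pair:
  fixes f :: "real \<times> 'a \<Rightarrow> 'b :: {banach, second_countable_topology}"
  assumes "prob_space N" and [measurable]: "f \<in> borel_measurable (measure_pmf sign_pmf \<Otimes>\<^sub>M N)"
    and "\<And>x. norm (f x) \<le> C"
  shows "(\<integral>x. f x \<partial>(measure_pmf sign_pmf \<Otimes>\<^sub>M N)) =
    (1 / 2) *\<^sub>R (\<integral>y. f (1, y) \<partial>N) + (1 / 2) *\<^sub>R (\<integral>y. f (- 1, y) \<partial>N)"
proof -
  interpret N: prob_space N by fact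
  interpret pair_prob_space "measure_pmf sign_pmf" N ..
  have "integrable (measure_pmf sign_pmf \<Otimes>\<^sub>M N) (case_prod (\<lambda>s y. f (s, y)))"
    by (rule P.integrable_const_bound [where B = C]) (use assms(3) in auto)
  from integral_fst [OF this]
  have "(\<integral>x. f x \<partial>(measure_pmf sign_pmf \<Otimes>\<^sub>M N)) = (\<integral>s. (\<integral>y. f (s, y) \<partial>N) \<partial>measure_pmf sign_pmf)"
    by simp
  also have "\<dots> = (\<Sum>s\<in>{1, - 1}. pmf sign_pmf s *\<^sub>R (\<integral>y. f (s, y) \<partial>N))"
    by (rule integral_measure_pmf) (auto simp: pmf_sign)
  finally show ?thesis by (simp add: pmf_sign)
qed

definition minkowski :: "real measure" where
  "minkowski = interval_measure minkowski_cdf"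

lemma
  shows real_distribution_minkowski: "real_distribution minkowski"
    and cdf_minkowski: "cdf minkowski = minkowski_cdf"
proof -
  have cont: "continuous (at_right a) minkowski_cdf" for a
    using continuous_minkowski_cdf
    by (simp add: continuous_on_eq_continuous_at continuous_at_imp_continuous_at_within)
  have bot: "(minkowski_cdf \<longlongrightarrow> 0) at_bot"
    by (rule tendsto_eventually) (auto simp: eventually_at_bot_linorder intro!: exI [of _ 0] minkowski_cdf_nonpos)
  have top: "(minkowski_cdf \<longlongrightarrow> 1) at_top"
    by (rule tendsto_eventually) (auto simp: eventually_at_top_linorder intro!: exI [of _ 1] minkowski_cdf_ge_1)
  show "real_distribution minkowski" "cdf minkowski = minkowski_cdf"
    unfolding minkowski_def using cont bot top monoD [OF mono_minkowski_cdf]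
    by (auto intro!: real_distribution_interval_measure cdf_interval_measure)
qed

interpretation minkowski: real_distribution minkowski
  by (rule real_distribution_minkowski)

lemma measure_minkowski_singleton: "measure minkowski {x} = 0"
  using minkowski.isCont_cdf [of x] continuous_minkowski_cdf
  by (simp add: cdf_minkowski continuous_on_eq_continuous_at)

lemma AE_minkowski_neq: "AE w in minkowski. w \<noteq> x"
  by (rule AE_I [of _ _ "{x}"]) (auto simp: minkowski.emeasure_eq_measure measure_minkowski_singleton)

lemma measure_minkowski_less: "measure minkowski {..<x} = minkowski_cdf x"
proof -
  have "measure minkowski ({..<x} \<union> {x}) = measure minkowski {..<x} + measure minkowski {x}"
    by (rule minkowski.finite_measure_Union) auto
  moreover have "{..<x} \<union> {x} = {..x}" by auto
  ultimately show ?thesis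
    using cdf_minkowski by (simp add: cdf_def fun_eq_iff measure_minkowski_singleton)
qed

lemma AE_minkowski: "AE w in minkowski. 0 < w \<and> w < 1"
proof -
  have "measure minkowski {..0} = 0"
    using cdf_minkowski by (simp add: cdf_def fun_eq_iff minkowski_cdf_nonpos)
  then have 1: "AE w in minkowski. \<not> w \<in> {..0}"
    by (intro AE_not_in) (auto simp: null_sets_def minkowski.emeasure_eq_measure)
  have "measure minkowski {..<1} = 1" by (simp add: measure_minkowski_less minkowski_cdf_ge_1)
  then have 2: "AE w in minkowski. w \<in> {..<1}"
    by (subst minkowski.AE_in_set_eq_1) auto
  from 1 2 show ?thesis by eventually_elim auto
qed

lemma
  assumes "0 < w" "w < 1"
  shows half_fold_le_iff: "w / (1 + w) \<le> x \<longleftrightarrow> w \<le> half_fold x"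
    and half_fold_less_iff: "w / (1 + w) < x \<longleftrightarrow> w < half_fold x"
proof -
  have "(w / (1 + w) \<le> x \<longleftrightarrow> w \<le> half_fold x) \<and> (w / (1 + w) < x \<longleftrightarrow> w < half_fold x)"
  proof (cases "x \<le> 1 / 2")
    case True
    then show ?thesis using assms by (auto simp: half_fold_left field_simps)
  next
    case False
    then have "w < half_fold x" using half_fold_ge_1 [of x] assms by simp
    moreover have "w / (1 + w) < 1 / 2" using assms by (simp add: field_simps)
    ultimately show ?thesis using False by (smt (verit))
  qed
  then show "w / (1 + w) \<le> x \<longleftrightarrow> w \<le> half_fold x" "w / (1 + w) < x \<longleftrightarrow> w < half_fold x"
    by auto
qed

text \<open>The law of \<open>W / (1 + W)\<close> or \<open>1 / (1 + W)\<close>, chosen by a fair sign. Comparing distribution functions,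
  the functional equation says that it is the law of \<open>W\<close> again.\<close>

definition fold_mixture :: "real measure" where
  "fold_mixture = distr (measure_pmf sign_pmf \<Otimes>\<^sub>M minkowski) borel
     (\<lambda>(s, w). if s = 1 then w / (1 + w) else 1 / (1 + w))"

lemma integral_fold_mixture:
  fixes f :: "real \<Rightarrow> 'b :: {banach, second_countable_topology}"
  assumes [measurable]: "f \<in> borel_measurable borel" and "\<And>x. norm (f x) \<le> C"
  shows "(\<integral>x. f x \<partial>fold_mixture) =
    (1 / 2) *\<^sub>R (\<integral>w. f (w / (1 + w)) \<partial>minkowski) + (1 / 2) *\<^sub>R (\<integral>w. f (1 / (1 + w)) \<partial>minkowski)"
  unfolding fold_mixture_def
  by (subst integral_distr, measurable, subst integral_sign_pair [where C = C])
     (use assms minkowski.prob_space_axioms in auto)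

lemma fold_mixture_eq: "fold_mixture = minkowski"
proof (rule cdf_unique)
  interpret pair_prob_space "measure_pmf sign_pmf" minkowski ..
  have "prob_space fold_mixture" unfolding fold_mixture_def
    by (rule P.prob_space_distr) measurable
  then show "real_distribution fold_mixture"
    by (simp add: real_distribution_def real_distribution_axioms_def fold_mixture_def)
  then interpret Z: real_distribution fold_mixture .
  show "cdf fold_mixture = cdf minkowski"
  proof
    fix x
    have "cdf fold_mixture x = (\<integral>y. indicator {..x} y \<partial>fold_mixture)"
      by (simp add: cdf_def)
    also have "\<dots> = (1 / 2) *\<^sub>R (\<integral>w. indicator {..x} (w / (1 + w)) \<partial>minkowski) +
        (1 / 2) *\<^sub>R (\<integral>w. indicator {..x} (1 / (1 + w)) \<partial>minkowski)"
      by (rule integral_fold_mixture [where C = 1]) (auto simp: indicator_def)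
    also have "(\<integral>w. indicator {..x} (w / (1 + w)) \<partial>minkowski) = (\<integral>w. indicator {..half_fold x} w \<partial>minkowski)"
      by (rule integral_cong_AE, simp, simp)
         (use AE_minkowski in \<open>eventually_elim, auto simp: indicator_def half_fold_le_iff\<close>)
    also have "\<dots> = minkowski_cdf (half_fold x)"
      using cdf_minkowski by (simp add: cdf_def fun_eq_iff)
    also have "(\<integral>w. indicator {..x} (1 / (1 + w)) \<partial>minkowski) =
        (\<integral>w. (1 :: real) - indicator {..<half_fold (1 - x)} w \<partial>minkowski)"
    proof (rule integral_cong_AE)
      show "AE w in minkowski. indicator {..x} (1 / (1 + w)) =
          (1 - indicator {..<half_fold (1 - x)} w :: real)"
        using AE_minkowski
      proof eventually_elim
        case (elim w)
        then have "1 / (1 + w) = 1 - w / (1 + w)" by (simp add: field_simps)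
        then have "1 / (1 + w) \<le> x \<longleftrightarrow> \<not> (w / (1 + w) < 1 - x)" by linarith
        then show ?case using half_fold_less_iff [of w "1 - x"] elim by (simp add: indicator_def)
      qed
    qed auto
    also have "\<dots> = 1 - minkowski_cdf (half_fold (1 - x))"
    proof -
      have "integrable minkowski (indicat_real {..<half_fold (1 - x)})"
        by (intro integrable_real_indicator) (auto simp: minkowski.emeasure_eq_measure)
      then show ?thesis
        using minkowski.prob_space
        by (subst Bochner_Integration.integral_diff) (simp_all add: measure_minkowski_less)
    qed
    finally show "cdf fold_mixture x = cdf minkowski x"
      using minkowski_cdf_fixpoint [of x] by (simp add: cdf_minkowski)
  qed
qed (rule real_distribution_minkowski)

lemma minkowski_self_similar:
  fixes f :: "real \<Rightarrow> 'b :: {banach, second_countable_topology}"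
  assumes "f \<in> borel_measurable borel" and "\<And>x. norm (f x) \<le> C"
  shows "(\<integral>w. f w \<partial>minkowski) =
    (1 / 2) *\<^sub>R (\<integral>w. f (w / (1 + w)) \<partial>minkowski) + (1 / 2) *\<^sub>R (\<integral>w. f (1 / (1 + w)) \<partial>minkowski)"
  using integral_fold_mixture [OF assms] by (simp add: fold_mixture_eq)

text \<open>Mean of \<open>f\<close> under the Denjoy--Minkowski law on the positive half-line, that of
  \<open>W powr S\<close> for an independent fair sign \<open>S\<close>.\<close>

definition pos_mean :: "(real \<Rightarrow> complex) \<Rightarrow> complex" where
  "pos_mean f = ((\<integral>w. f w \<partial>minkowski) + (\<integral>w. f (1 / w) \<partial>minkowski)) / 2"

lemma minkowski_integral_cong:
  fixes f g :: "real \<Rightarrow> complex"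
  assumes [measurable]: "f \<in> borel_measurable borel" "g \<in> borel_measurable borel"
    and "\<And>w. 0 < w \<Longrightarrow> w < 1 \<Longrightarrow> f w = g w"
  shows "(\<integral>w. f w \<partial>minkowski) = (\<integral>w. g w \<partial>minkowski)"
  by (rule integral_cong_AE, simp, simp) (use AE_minkowski in \<open>eventually_elim, auto intro: assms(3)\<close>)

lemma pos_mean_cong:
  assumes [measurable]: "f \<in> borel_measurable borel" "g \<in> borel_measurable borel"
    and "\<And>x. x > 0 \<Longrightarrow> f x = g x"
  shows "pos_mean f = pos_mean g"
  unfolding pos_mean_def
  by (intro arg_cong2 [where f = "\<lambda>x y. (x + y) / 2"] minkowski_integral_cong) (auto intro: assms(3))

lemma pos_mean_inverse: "pos_mean (\<lambda>x. f (1 / x)) = pos_mean f"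
  by (simp add: pos_mean_def add.commute)

text \<open>If \<open>Y = W powr S\<close>, then \<open>Y / (1 + Y)\<close> is \<open>W / (1 + W)\<close> or \<open>1 / (1 + W)\<close> according to the sign, so it
  has the law of \<open>W\<close> by self-similarity.\<close>

lemma pos_mean_contract:
  assumes [measurable]: "f \<in> borel_measurable borel" and "\<And>x. norm (f x) \<le> C"
  shows "pos_mean (\<lambda>x. f (x / (1 + x))) = (\<integral>w. f w \<partial>minkowski)"
proof -
  have "(\<integral>w. f (1 / w / (1 + 1 / w)) \<partial>minkowski) = (\<integral>w. f (1 / (1 + w)) \<partial>minkowski)"
  proof (rule minkowski_integral_cong)
    fix w :: real assume "0 < w"
    then have "1 / w / (1 + 1 / w) = 1 / (1 + w)" by (simp add: field_simps)
    then show "f (1 / w / (1 + 1 / w)) = f (1 / (1 + w))" by (rule arg_cong)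
  qed auto
  then show ?thesis
    using minkowski_self_similar [OF assms]
    by (simp add: pos_mean_def scaleR_conv_of_real add_divide_distrib)
qed

lemma pos_mean_shift:
  assumes [measurable]: "f \<in> borel_measurable borel" and "\<And>x. norm (f x) \<le> C"
  shows "pos_mean (\<lambda>x. f (1 + x)) = (\<integral>w. f (1 / w) \<partial>minkowski)"
proof -
  have "(\<integral>w. f (1 / w) \<partial>minkowski) = pos_mean (\<lambda>x. f (1 / (x / (1 + x))))"
    by (rule pos_mean_contract [symmetric]) (use assms(2) in auto)
  also have "\<dots> = pos_mean (\<lambda>x. f (1 + 1 / x))"
  proof (rule pos_mean_cong)
    fix x :: real assume "x > 0"
    then have "1 / (x / (1 + x)) = 1 + 1 / x" by (simp add: field_simps)
    then show "f (1 / (x / (1 + x))) = f (1 + 1 / x)" by (rule arg_cong)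
  qed auto
  also have "\<dots> = pos_mean (\<lambda>x. f (1 + x))" by (rule pos_mean_inverse)
  finally show ?thesis ..
qed

text \<open>The tree structure of the law on the half-line: its halves above and below 1 are its images
  under \<open>x \<mapsto> 1 + x\<close> and \<open>x \<mapsto> x / (1 + x)\<close>, each with weight \<open>1 / 2\<close>.\<close>

lemma pos_mean_split:
  assumes [measurable]: "f \<in> borel_measurable borel" and "\<And>x. norm (f x) \<le> C"
  shows "pos_mean f = (pos_mean (\<lambda>x. f (1 + x)) + pos_mean (\<lambda>x. f (x / (1 + x)))) / 2"
  unfolding pos_mean_shift [OF assms] pos_mean_contract [OF assms]
  by (simp add: pos_mean_def add.commute)

text \<open>Mean under the two-sided law, that of \<open>S2 * W powr S1\<close>.\<close>

definition sym_mean :: "(real \<Rightarrow> complex) \<Rightarrow> complex" where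
  "sym_mean f = (pos_mean f + pos_mean (\<lambda>x. f (- x))) / 2"

text \<open>Stationarity. The four numbers \<open>a\<close>, \<open>b\<close>, \<open>a'\<close>, \<open>b'\<close> are the means of \<open>f\<close> over the laws conditioned to
  \<open>x > 1\<close>, \<open>0 < x < 1\<close>, \<open>x < - 1\<close> and \<open>- 1 < x < 0\<close>. Each of the nine maps and each sign of the
  argument either sends the half-line onto one of these pieces or onto a whole half-line, or becomes
  such a map on both branches \<open>1 + x\<close> and \<open>x / (1 + x)\<close>. Every mean is thus a combination of the four
  numbers, and the combinations add up.\<close>

lemma sym_mean_sum_steps:
  assumes f [measurable]: "f \<in> borel_measurable borel" and bd: "\<And>x. norm (f x) \<le> C"
  shows "sym_mean (\<lambda>x. f (- 1 / x)) + sym_mean (\<lambda>x. f (1 + x)) + sym_mean (\<lambda>x. f (- 1 + x)) +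
    sym_mean (\<lambda>x. f ((x - 1) / x)) + sym_mean (\<lambda>x. f ((- 1 - x) / x)) + sym_mean (\<lambda>x. f (x / (1 + x))) +
    sym_mean (\<lambda>x. f (x / (1 - x))) + sym_mean (\<lambda>x. f (- 1 / (1 + x))) + sym_mean (\<lambda>x. f (1 / (1 - x))) =
    9 * sym_mean f"
proof -
  define a where "a = (\<integral>w. f (1 / w) \<partial>minkowski)"
  define b where "b = (\<integral>w. f w \<partial>minkowski)"
  define a' where "a' = (\<integral>w. f (- (1 / w)) \<partial>minkowski)"
  define b' where "b' = (\<integral>w. f (- w) \<partial>minkowski)"
  have m: "pos_mean (\<lambda>x. f x) = (a + b) / 2" "pos_mean (\<lambda>x. f (1 / x)) = (a + b) / 2"
      "pos_mean (\<lambda>x. f (- x)) = (a' + b') / 2" "pos_mean (\<lambda>x. f (- (1 / x))) = (a' + b') / 2"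
    by (simp_all add: pos_mean_def a_def b_def a'_def b'_def add.commute)
  have ab: "pos_mean (\<lambda>x. f (1 + x)) = a" "pos_mean (\<lambda>x. f (x / (1 + x))) = b"
      "pos_mean (\<lambda>x. f (- (1 + x))) = a'" "pos_mean (\<lambda>x. f (- (x / (1 + x)))) = b'"
    using pos_mean_shift [OF f bd] pos_mean_contract [OF f bd]
      pos_mean_shift [of "\<lambda>x. f (- x)" C] pos_mean_contract [of "\<lambda>x. f (- x)" C] bd
    by (simp_all add: a_def b_def a'_def b'_def)
  have ab_inv: "pos_mean (\<lambda>x. f (1 + 1 / x)) = a" "pos_mean (\<lambda>x. f (- (1 + 1 / x))) = a'"
    using pos_mean_inverse [of "\<lambda>x. f (1 + x)"] pos_mean_inverse [of "\<lambda>x. f (- (1 + x))"] ab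
    by simp_all
  have contr: "pos_mean (\<lambda>x. f (1 / (1 + x))) = b" "pos_mean (\<lambda>x. f (- (1 / (1 + x)))) = b'"
  proof -
    have "pos_mean (\<lambda>x. f (1 / (1 + x))) = pos_mean (\<lambda>x. f ((1 / x) / (1 + 1 / x)))"
    proof (rule pos_mean_cong)
      fix x :: real assume "x > 0"
      then have "1 / (1 + x) = (1 / x) / (1 + 1 / x)" by (simp add: field_simps)
      then show "f (1 / (1 + x)) = f ((1 / x) / (1 + 1 / x))" by (rule arg_cong)
    qed auto
    then show "pos_mean (\<lambda>x. f (1 / (1 + x))) = b"
      using pos_mean_inverse [of "\<lambda>x. f (x / (1 + x))"] ab by simp
    have "pos_mean (\<lambda>x. f (- (1 / (1 + x)))) = pos_mean (\<lambda>x. f (- ((1 / x) / (1 + 1 / x))))"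
    proof (rule pos_mean_cong)
      fix x :: real assume "x > 0"
      then have "- (1 / (1 + x)) = - ((1 / x) / (1 + 1 / x))" by (simp add: field_simps)
      then show "f (- (1 / (1 + x))) = f (- ((1 / x) / (1 + 1 / x)))" by (rule arg_cong)
    qed auto
    then show "pos_mean (\<lambda>x. f (- (1 / (1 + x)))) = b'"
      using pos_mean_inverse [of "\<lambda>x. f (- (x / (1 + x)))"] ab by simp
  qed
  have direct: "pos_mean (\<lambda>x. f (h x)) = u"
    if k: "pos_mean (\<lambda>x. f (k x)) = u"
      and [measurable]: "h \<in> borel_measurable borel" "k \<in> borel_measurable borel"
      and eq: "\<And>x. x > 0 \<Longrightarrow> h x = k x" for h k u
    unfolding k [symmetric] by (rule pos_mean_cong) (use eq in auto)
  have split: "pos_mean (\<lambda>x. f (h x)) = (u + v) / 2"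
    if k: "pos_mean (\<lambda>x. f (k x)) = u" and l: "pos_mean (\<lambda>x. f (l x)) = v"
      and [measurable]: "h \<in> borel_measurable borel" "k \<in> borel_measurable borel" "l \<in> borel_measurable borel"
      and "\<And>x. x > 0 \<Longrightarrow> h (1 + x) = k x" "\<And>x. x > 0 \<Longrightarrow> h (x / (1 + x)) = l x" for h k l u v
    using pos_mean_split [of "\<lambda>x. f (h x)" C] bd
      direct [OF k, of "\<lambda>x. h (1 + x)"] direct [OF l, of "\<lambda>x. h (x / (1 + x))"] that(6,7) by simp
  have h0: "sym_mean (\<lambda>x. f (- 1 / x)) = ((a' + b') / 2 + (a + b) / 2) / 2"
  proof -
    have "pos_mean (\<lambda>x. f (- 1 / x)) = (a' + b') / 2"
      by (rule direct [OF m(4)]) (auto simp: field_simps)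
    moreover have "pos_mean (\<lambda>x. f (- 1 / (- x))) = (a + b) / 2"
      by (rule direct [OF m(2)]) (auto simp: field_simps)
    ultimately show ?thesis by (simp only: sym_mean_def)
  qed
  have h1: "sym_mean (\<lambda>x. f (1 + x)) = (a + ((a' + b') / 2 + b) / 2) / 2"
  proof -
    have "pos_mean (\<lambda>x. f (1 + x)) = a"
      by (rule direct [OF ab(1)]) (auto simp: field_simps)
    moreover have "pos_mean (\<lambda>x. f (1 + (- x))) = ((a' + b') / 2 + b) / 2"
      by (rule split [OF m(3) contr(1)]) (auto simp: field_simps)
    ultimately show ?thesis by (simp only: sym_mean_def)
  qed
  have h2: "sym_mean (\<lambda>x. f (- 1 + x)) = (((a + b) / 2 + b') / 2 + a') / 2"
  proof -
    have "pos_mean (\<lambda>x. f (- 1 + x)) = ((a + b) / 2 + b') / 2"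
      by (rule split [OF m(1) contr(2)]) (auto simp: field_simps)
    moreover have "pos_mean (\<lambda>x. f (- 1 + (- x))) = a'"
      by (rule direct [OF ab(3)]) (auto simp: field_simps)
    ultimately show ?thesis by (simp only: sym_mean_def)
  qed
  have h3: "sym_mean (\<lambda>x. f ((x - 1) / x)) = ((b + (a' + b') / 2) / 2 + a) / 2"
  proof -
    have "pos_mean (\<lambda>x. f ((x - 1) / x)) = (b + (a' + b') / 2) / 2"
      by (rule split [OF ab(2) m(4)]) (auto simp: field_simps)
    moreover have "pos_mean (\<lambda>x. f (((- x) - 1) / (- x))) = a"
      by (rule direct [OF ab_inv(1)]) (auto simp: field_simps)
    ultimately show ?thesis by (simp only: sym_mean_def)
  qed
  have h4: "sym_mean (\<lambda>x. f ((- 1 - x) / x)) = (a' + (b' + (a + b) / 2) / 2) / 2"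
  proof -
    have "pos_mean (\<lambda>x. f ((- 1 - x) / x)) = a'"
      by (rule direct [OF ab_inv(2)]) (auto simp: field_simps)
    moreover have "pos_mean (\<lambda>x. f ((- 1 - (- x)) / (- x))) = (b' + (a + b) / 2) / 2"
      by (rule split [OF ab(4) m(2)]) (auto simp: field_simps)
    ultimately show ?thesis by (simp only: sym_mean_def)
  qed
  have h5: "sym_mean (\<lambda>x. f (x / (1 + x))) = (b + (a + (a' + b') / 2) / 2) / 2"
  proof -
    have "pos_mean (\<lambda>x. f (x / (1 + x))) = b"
      by (rule direct [OF ab(2)]) (auto simp: field_simps)
    moreover have "pos_mean (\<lambda>x. f ((- x) / (1 + (- x)))) = (a + (a' + b') / 2) / 2"
      by (rule split [OF ab_inv(1) m(3)]) (auto simp: field_simps)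
    ultimately show ?thesis by (simp only: sym_mean_def)
  qed
  have h6: "sym_mean (\<lambda>x. f (x / (1 - x))) = ((a' + (a + b) / 2) / 2 + b') / 2"
  proof -
    have "pos_mean (\<lambda>x. f (x / (1 - x))) = (a' + (a + b) / 2) / 2"
      by (rule split [OF ab_inv(2) m(1)]) (auto simp: field_simps)
    moreover have "pos_mean (\<lambda>x. f ((- x) / (1 - (- x)))) = b'"
      by (rule direct [OF ab(4)]) (auto simp: field_simps)
    ultimately show ?thesis by (simp only: sym_mean_def)
  qed
  have h7: "sym_mean (\<lambda>x. f (- 1 / (1 + x))) = (b' + ((a + b) / 2 + a') / 2) / 2"
  proof -
    have "pos_mean (\<lambda>x. f (- 1 / (1 + x))) = b'"
      by (rule direct [OF contr(2)]) (auto simp: field_simps)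
    moreover have "pos_mean (\<lambda>x. f (- 1 / (1 + (- x)))) = ((a + b) / 2 + a') / 2"
      by (rule split [OF m(2) ab(3)]) (auto simp: field_simps)
    ultimately show ?thesis by (simp only: sym_mean_def)
  qed
  have h8: "sym_mean (\<lambda>x. f (1 / (1 - x))) = (((a' + b') / 2 + a) / 2 + b) / 2"
  proof -
    have "pos_mean (\<lambda>x. f (1 / (1 - x))) = ((a' + b') / 2 + a) / 2"
      by (rule split [OF m(4) ab(1)]) (auto simp: field_simps)
    moreover have "pos_mean (\<lambda>x. f (1 / (1 - (- x)))) = b"
      by (rule direct [OF contr(1)]) (auto simp: field_simps)
    ultimately show ?thesis by (simp only: sym_mean_def)
  qed
  have h: "sym_mean f = ((a + b) / 2 + (a' + b') / 2) / 2"
    by (simp only: sym_mean_def m)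
  show ?thesis
    unfolding h0 h1 h2 h3 h4 h5 h6 h7 h8 h by (simp add: field_simps)
qed

definition sign_space :: "(real \<times> real \<times> real) measure" where
  "sign_space = measure_pmf sign_pmf \<Otimes>\<^sub>M measure_pmf sign_pmf \<Otimes>\<^sub>M minkowski"

text \<open>The value \<open>1 / 2\<close> on the null set outside the unit interval makes the range condition on \<open>W\<close> hold
  everywhere and not only almost everywhere.\<close>

definition unit_part :: "real \<times> real \<times> real \<Rightarrow> real" where
  "unit_part \<omega> = (if 0 < snd (snd \<omega>) \<and> snd (snd \<omega>) < 1 then snd (snd \<omega>) else 1 / 2)"

lemma sets_sign_space [measurable_cong]:
  "sets sign_space = sets (count_space UNIV \<Otimes>\<^sub>M count_space UNIV \<Otimes>\<^sub>M borel)"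
  unfolding sign_space_def by (intro sets_pair_measure_cong) simp_all

lemma
  shows measurable_sign1 [measurable]: "fst \<in> borel_measurable sign_space"
    and measurable_sign2 [measurable]: "(\<lambda>\<omega>. fst (snd \<omega>)) \<in> borel_measurable sign_space"
    and measurable_unit_part [measurable]: "unit_part \<in> borel_measurable sign_space"
proof -
  show "fst \<in> borel_measurable sign_space"
    unfolding sign_space_def by (rule measurable_fst'' [of "\<lambda>x. x"]) simp
  show "(\<lambda>\<omega>. fst (snd \<omega>)) \<in> borel_measurable sign_space"
    unfolding sign_space_def by (rule measurable_snd'', rule measurable_fst'' [of "\<lambda>x. x"]) simp
  have [measurable]: "(\<lambda>\<omega>. snd (snd \<omega>)) \<in> borel_measurable sign_space"
    unfolding sign_space_def by (rule measurable_snd'', rule measurable_snd'' [of "\<lambda>x. x"]) simp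
  show "unit_part \<in> borel_measurable sign_space"
    unfolding unit_part_def [abs_def] by measurable
qed

lemma prob_space_sign_space: "prob_space sign_space"
  unfolding sign_space_def
  by (intro prob_space_pair measure_pmf.prob_space_axioms minkowski.prob_space_axioms)

lemma space_sign_space: "space sign_space = UNIV"
  by (simp add: sign_space_def space_pair_measure)

lemma measure_sign_space_Times:
  assumes "C \<in> sets borel"
  shows "measure sign_space (A \<times> B \<times> C) =
    measure sign_pmf A * measure sign_pmf B * measure minkowski C"
proof -
  interpret inner: pair_prob_space "measure_pmf sign_pmf" minkowski ..
  have "B \<times> C \<in> sets (measure_pmf sign_pmf \<Otimes>\<^sub>M minkowski)" using assms by auto
  then show ?thesis
    unfolding sign_space_def using assms
    by (simp add: measure_def inner.P.emeasure_pair_measure_Times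
        minkowski.emeasure_pair_measure_Times enn2real_mult mult.assoc)
qed

lemma measure_unit_part_less:
  "measure sign_space {\<omega> \<in> space sign_space. unit_part \<omega> < x} = minkowski_cdf x"
proof -
  let ?B = "{w. (if 0 < w \<and> w < 1 then w else 1 / 2) < x} :: real set"
  have [measurable]: "?B \<in> sets borel" by measurable
  have "{\<omega> \<in> space sign_space. unit_part \<omega> < x} = UNIV \<times> UNIV \<times> ?B"
    by (auto simp: space_sign_space unit_part_def split: prod.splits)
  then have "measure sign_space {\<omega> \<in> space sign_space. unit_part \<omega> < x} = measure minkowski ?B"
    by (simp add: measure_sign_space_Times)
  also have "\<dots> = measure minkowski {..<x}"
  proof (rule minkowski.finite_measure_eq_AE)
    show "AE w in minkowski. (w \<in> ?B) = (w \<in> {..<x})"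
      using AE_minkowski by eventually_elim auto
  qed auto
  finally show ?thesis by (simp add: measure_minkowski_less)
qed

lemma signs_and_minkowski_sign_space:
  "signs_and_minkowski sign_space fst (\<lambda>\<omega>. fst (snd \<omega>)) unit_part"
  unfolding signs_and_minkowski_def
proof (intro conjI ballI prob_space_sign_space)
  interpret prob_space sign_space by (rule prob_space_sign_space)
  let ?X = "\<lambda>i. [fst, \<lambda>\<omega>. fst (snd \<omega>), unit_part] ! i"
  have idx: "{..<3} = {0, 1, 2 :: nat}" by auto
  show "indep_vars (\<lambda>_. borel) ?X {..<3}"
  proof (subst indep_vars_finite [where E = "\<lambda>_. sets borel"])
    show "\<forall>A\<in>(\<Pi> i\<in>{..<3}. sets borel).
      prob (\<Inter>j\<in>{..<3}. ?X j -` A j \<inter> space sign_space) = (\<Prod>j\<in>{..<3}. prob (?X j -` A j \<inter> space sign_space))"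
    proof
      fix A :: "nat \<Rightarrow> real set" assume "A \<in> (\<Pi> i\<in>{..<3}. sets borel)"
      then have [measurable]: "A 2 \<in> sets borel" by auto
      let ?C = "{w. (if 0 < w \<and> w < 1 then w else 1 / 2) \<in> A 2} :: real set"
      have C: "?C \<in> sets borel" by measurable
      have "(\<Inter>j\<in>{..<3}. ?X j -` A j \<inter> space sign_space) = A 0 \<times> A 1 \<times> ?C"
        unfolding idx by (auto simp: space_sign_space unit_part_def)
      moreover have "?X 0 -` A 0 \<inter> space sign_space = A 0 \<times> (UNIV \<times> UNIV)"
        "?X 1 -` A 1 \<inter> space sign_space = UNIV \<times> A 1 \<times> UNIV"
        "?X 2 -` A 2 \<inter> space sign_space = UNIV \<times> UNIV \<times> ?C"
        by (auto simp: space_sign_space unit_part_def)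
      ultimately show "prob (\<Inter>j\<in>{..<3}. ?X j -` A j \<inter> space sign_space) = (\<Prod>j\<in>{..<3}. prob (?X j -` A j \<inter> space sign_space))"
        unfolding idx using C minkowski.prob_space
        by (simp add: measure_sign_space_Times del: UNIV_Times_UNIV)
    qed
  next
    fix i :: nat assume "i \<in> {..<3}"
    then consider "i = 0" | "i = 1" | "i = 2" by force
    then show "random_variable borel (?X i)" by cases simp_all
  qed (auto simp: idx sets.sigma_sets_eq [of borel, simplified] intro: sets.Int_stable)
next
  fix S :: "real \<times> real \<times> real \<Rightarrow> real" assume "S \<in> {fst, \<lambda>\<omega>. fst (snd \<omega>)}"
  then consider "S = fst" | "S = (\<lambda>\<omega>. fst (snd \<omega>))" by auto
  note S = this
  have *: "measure sign_space {\<omega> \<in> space sign_space. S \<omega> = c} = pmf sign_pmf c" for c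
    using S
  proof cases
    case 1
    then have "{\<omega> \<in> space sign_space. S \<omega> = c} = {c} \<times> UNIV \<times> UNIV" by (auto simp: space_sign_space)
    then show ?thesis using minkowski.prob_space
      by (simp add: measure_sign_space_Times measure_pmf_single del: UNIV_Times_UNIV)
  next
    case 2
    then have "{\<omega> \<in> space sign_space. S \<omega> = c} = UNIV \<times> {c} \<times> UNIV" by (auto simp: space_sign_space)
    then show ?thesis using minkowski.prob_space
      by (simp add: measure_sign_space_Times measure_pmf_single del: UNIV_Times_UNIV)
  qed
  show "measure sign_space {\<omega> \<in> space sign_space. S \<omega> = 1} = 1 / 2"
    "measure sign_space {\<omega> \<in> space sign_space. S \<omega> = - 1} = 1 / 2"
    by (simp_all add: * pmf_sign)
next
  fix \<omega> show "unit_part \<omega> \<in> {0<..<1}" by (auto simp: unit_part_def split: prod.splits)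
next
  fix w :: real assume "w \<in> {0..1}"
  then show "measure sign_space {\<omega> \<in> space sign_space. unit_part \<omega> < w} = question_mark w"
    by (simp add: measure_unit_part_less question_mark_eq)
qed

definition signed_minkowski :: "real measure" where
  "signed_minkowski = distr sign_space borel (\<lambda>\<omega>. fst (snd \<omega>) * unit_part \<omega> powr fst \<omega>)"

lemma sets_signed_minkowski [measurable_cong]: "sets signed_minkowski = sets borel"
  by (simp add: signed_minkowski_def)

lemma real_distribution_signed_minkowski: "real_distribution signed_minkowski"
proof -
  interpret prob_space sign_space by (rule prob_space_sign_space)
  show ?thesis unfolding signed_minkowski_def by (rule real_distribution_distr) measurable
qed

lemma integral_signed_minkowski:
  fixes f :: "real \<Rightarrow> complex"
  assumes [measurable]: "f \<in> borel_measurable borel" and "\<And>x. norm (f x) \<le> C"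
  shows "(\<integral>x. f x \<partial>signed_minkowski) = sym_mean f"
proof -
  interpret inner: pair_prob_space "measure_pmf sign_pmf" minkowski ..
  define h where "h = (\<lambda>\<omega>. f (fst (snd \<omega>) * unit_part \<omega> powr fst \<omega>))"
  have hm [measurable]: "h \<in> borel_measurable sign_space" unfolding h_def by measurable
  have bd: "norm (h x) \<le> C" for x using assms(2) by (simp add: h_def)
  have hm1 [measurable]: "(\<lambda>y. h (s, y)) \<in> borel_measurable (measure_pmf sign_pmf \<Otimes>\<^sub>M minkowski)" for s
    by (rule measurable_compose_Pair1 [OF _ hm [unfolded sign_space_def]]) simp
  have w: "(\<integral>w. h (s, t, w) \<partial>minkowski) = (\<integral>w. f (t * w powr s) \<partial>minkowski)" for s t
  proof (rule integral_cong_AE)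
    show "(\<lambda>w. h (s, t, w)) \<in> borel_measurable minkowski"
      by (rule measurable_compose_Pair1 [OF _ hm1]) simp
    show "AE w in minkowski. h (s, t, w) = f (t * w powr s)"
      using AE_minkowski by eventually_elim (auto simp: h_def unit_part_def)
  qed measurable
  have inner: "(\<integral>y. h (s, y) \<partial>(measure_pmf sign_pmf \<Otimes>\<^sub>M minkowski)) =
      (1 / 2) *\<^sub>R (\<integral>w. f (1 * w powr s) \<partial>minkowski) + (1 / 2) *\<^sub>R (\<integral>w. f (- 1 * w powr s) \<partial>minkowski)" for s
    unfolding w [symmetric]
    by (rule integral_sign_pair [OF minkowski.prob_space_axioms _ bd]) measurable
  have powr: "(\<integral>w. f (c * w powr 1) \<partial>minkowski) = (\<integral>w. f (c * w) \<partial>minkowski)"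
    "(\<integral>w. f (c * w powr - 1) \<partial>minkowski) = (\<integral>w. f (c * (1 / w)) \<partial>minkowski)" for c
    by (rule minkowski_integral_cong; auto simp: powr_minus_divide)+
  have "(\<integral>x. f x \<partial>signed_minkowski) = (\<integral>\<omega>. h \<omega> \<partial>sign_space)"
    unfolding signed_minkowski_def h_def by (rule integral_distr) measurable
  also have "\<dots> = (1 / 2) *\<^sub>R (\<integral>y. h (1, y) \<partial>(measure_pmf sign_pmf \<Otimes>\<^sub>M minkowski)) +
      (1 / 2) *\<^sub>R (\<integral>y. h (- 1, y) \<partial>(measure_pmf sign_pmf \<Otimes>\<^sub>M minkowski))"
    unfolding sign_space_def
    by (rule integral_sign_pair [OF inner.P.prob_space_axioms hm [unfolded sign_space_def] bd])
  also have "\<dots> = sym_mean f"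
    unfolding inner powr sym_mean_def pos_mean_def by (simp add: scaleR_conv_of_real field_simps)
  finally show ?thesis .
qed

lemma AE_signed_minkowski_neq: "AE x in signed_minkowski. x \<noteq> y"
proof -
  interpret mu: real_distribution signed_minkowski by (rule real_distribution_signed_minkowski)
  have z: "(\<integral>w. indicator {y} (h w) \<partial>minkowski) = (0 :: complex)"
    if [measurable]: "h \<in> borel_measurable borel" and "\<And>w. 0 < w \<Longrightarrow> h w = y \<Longrightarrow> w = c" for h c
  proof -
    have "(\<integral>w. indicator {y} (h w) \<partial>minkowski) = (\<integral>w. (0 :: complex) \<partial>minkowski)"
    proof (rule integral_cong_AE)
      show "AE w in minkowski. indicator {y} (h w) = (0 :: complex)"
        using AE_minkowski AE_minkowski_neq [of c]
      proof eventually_elim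
        case (elim w)
        then have "h w \<noteq> y" using that(2) by blast
        then show ?case by simp
      qed
    qed measurable
    then show ?thesis by simp
  qed
  have "of_real (measure signed_minkowski {y}) = (\<integral>x. complex_of_real (indicator {y} x) \<partial>signed_minkowski)"
    unfolding integral_complex_of_real by simp
  also have "\<dots> = (\<integral>x. indicator {y} x \<partial>signed_minkowski)"
    by (rule arg_cong [where f = "integral\<^sup>L signed_minkowski"]) (auto simp: indicator_def)
  also have "\<dots> = sym_mean (indicator {y})"
    by (rule integral_signed_minkowski [where C = 1]) (auto simp: indicator_def)
  also have "\<dots> = 0"
  proof -
    have "(\<integral>w. indicator {y} (1 / w) \<partial>minkowski) = (0 :: complex)"
      "(\<integral>w. indicator {y} (- (1 / w)) \<partial>minkowski) = (0 :: complex)"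
      by (rule z [of _ "1 / y"], measurable, auto) (rule z [of _ "- (1 / y)"], measurable, auto)
    then show ?thesis
      using z [of "\<lambda>w. w" y] z [of "\<lambda>w. - w" "- y"] by (simp add: sym_mean_def pos_mean_def)
  qed
  finally have "measure signed_minkowski {y} = 0" by simp
  then show ?thesis
    by (intro AE_I [of _ _ "{y}"]) (auto simp: mu.emeasure_eq_measure)
qed

text \<open>The boundary action: \<open>mobius\<close> on the real line, with the value 0 at a pole.\<close>

definition real_mobius :: "psl2z \<Rightarrow> real \<Rightarrow> real" where
  "real_mobius A x = Re (mobius A (of_real x))"

lemma real_mobius_of:
  "a * d - b * c = 1 \<Longrightarrow> real_mobius (psl2z_of a b c d) x = (of_int a * x + of_int b) / (of_int c * x + of_int d)"
proof -
  assume "a * d - b * c = 1"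
  then have "mobius (psl2z_of a b c d) (of_real x) =
      of_real ((of_int a * x + of_int b) / (of_int c * x + of_int d))"
    by (simp add: mobius_of)
  then show ?thesis by (simp add: real_mobius_def)
qed

lemma measurable_real_mobius [measurable]: "real_mobius A \<in> borel_measurable borel"
proof -
  obtain a b c d where "A = psl2z_of a b c d" "a * d - b * c = 1" by (rule psl2z_exhaust)
  then have "real_mobius A = (\<lambda>x. (of_int a * x + of_int b) / (of_int c * x + of_int d))"
    by (auto simp: real_mobius_of)
  then show ?thesis by simp
qed

text \<open>At the pole of \<open>B\<close> the convention for division by zero breaks the action, but a measure without
  atoms does not see this point.\<close>

lemma real_mobius_mult_AE:
  "AE x in signed_minkowski. real_mobius (A * B) x = real_mobius A (real_mobius B x)"
proof -
  obtain a b c d where B: "B = psl2z_of a b c d" and det: "a * d - b * c = 1" by (rule psl2z_exhaust)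
  show ?thesis
    using AE_signed_minkowski_neq [of "- (of_int d / of_int c)"]
  proof eventually_elim
    case (elim x)
    have "of_int c * x + of_int d \<noteq> 0"
    proof
      assume *: "of_int c * x + of_int d = 0"
      show False
      proof (cases "c = 0")
        case True
        then show False using * det by simp
      next
        case False
        then have "x = - (of_int d / of_int c)" using * by (simp add: field_simps)
        then show False using elim by simp
      qed
    qed
    then have "of_int c * complex_of_real x + of_int d \<noteq> 0"
      by (metis of_real_add of_real_eq_0_iff of_real_mult of_real_of_int_eq)
    then have "real_mobius (A * B) x = Re (mobius A (mobius B (of_real x)))"
      unfolding real_mobius_def B using det by (intro arg_cong [where f = Re] mobius_mult)
    also have "mobius B (of_real x) = of_real (real_mobius B x)"
      using det by (simp add: B real_mobius_of mobius_of)
    finally show ?case by (simp only: real_mobius_def [of A])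
  qed
qed

lemma signed_minkowski_stationary:
  fixes f :: "real \<Rightarrow> complex"
  assumes [measurable]: "f \<in> borel_measurable borel" and bd: "\<And>x. norm (f x) \<le> C"
  shows "(\<Sum>s\<in>steps. \<integral>x. f (real_mobius (A * s) x) \<partial>signed_minkowski) =
    9 * (\<integral>x. f (real_mobius A x) \<partial>signed_minkowski)"
proof -
  define g where "g = (\<lambda>x. f (real_mobius A x))"
  have [measurable]: "g \<in> borel_measurable borel" unfolding g_def by measurable
  have g: "norm (g x) \<le> C" for x using bd by (simp add: g_def)
  have "(\<integral>x. f (real_mobius (A * s) x) \<partial>signed_minkowski) = sym_mean (\<lambda>x. g (real_mobius s x))" for s
  proof -
    have "(\<integral>x. f (real_mobius (A * s) x) \<partial>signed_minkowski) = (\<integral>x. g (real_mobius s x) \<partial>signed_minkowski)"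
    proof (rule integral_cong_AE)
      show "AE x in signed_minkowski. f (real_mobius (A * s) x) = g (real_mobius s x)"
        using real_mobius_mult_AE [of A s] by eventually_elim (simp add: g_def)
    qed measurable
    also have "\<dots> = sym_mean (\<lambda>x. g (real_mobius s x))"
      by (rule integral_signed_minkowski [OF _ g]) measurable
    finally show ?thesis .
  qed
  then have "(\<Sum>s\<in>steps. \<integral>x. f (real_mobius (A * s) x) \<partial>signed_minkowski) =
      (\<Sum>s\<in>steps. sym_mean (\<lambda>x. g (real_mobius s x)))" by simp
  also have "\<dots> = 9 * sym_mean g"
  proof -
    have rm: "real_mobius (psl2z_of 0 (- 1) 1 0) = (\<lambda>x. - 1 / x)"
      "real_mobius (psl2z_of 1 1 0 1) = (\<lambda>x. 1 + x)"
      "real_mobius (psl2z_of 1 (- 1) 0 1) = (\<lambda>x. - 1 + x)"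
      "real_mobius (psl2z_of 1 (- 1) 1 0) = (\<lambda>x. (x - 1) / x)"
      "real_mobius (psl2z_of (- 1) (- 1) 1 0) = (\<lambda>x. (- 1 - x) / x)"
      "real_mobius (psl2z_of 1 0 1 1) = (\<lambda>x. x / (1 + x))"
      "real_mobius (psl2z_of 1 0 (- 1) 1) = (\<lambda>x. x / (1 - x))"
      "real_mobius (psl2z_of 0 (- 1) 1 1) = (\<lambda>x. - 1 / (1 + x))"
      "real_mobius (psl2z_of 0 1 (- 1) 1) = (\<lambda>x. 1 / (1 - x))"
      by (auto simp: real_mobius_of add.commute)
    have "(\<Sum>s\<in>steps. sym_mean (\<lambda>x. g (real_mobius s x))) =
      sym_mean (\<lambda>x. g (- 1 / x)) + sym_mean (\<lambda>x. g (1 + x)) + sym_mean (\<lambda>x. g (- 1 + x)) +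
      sym_mean (\<lambda>x. g ((x - 1) / x)) + sym_mean (\<lambda>x. g ((- 1 - x) / x)) +
      sym_mean (\<lambda>x. g (x / (1 + x))) + sym_mean (\<lambda>x. g (x / (1 - x))) +
      sym_mean (\<lambda>x. g (- 1 / (1 + x))) + sym_mean (\<lambda>x. g (1 / (1 - x)))"
      unfolding steps_eq by (simp add: psl2z_of_eq_iff rm add.assoc)
    also have "\<dots> = 9 * sym_mean g"
      by (rule sym_mean_sum_steps [OF _ g]) measurable
    finally show ?thesis .
  qed
  also have "sym_mean g = (\<integral>x. f (real_mobius A x) \<partial>signed_minkowski)"
    using g integral_signed_minkowski [of g C] by (simp add: g_def)
  finally show ?thesis .
qed

section \<open>Growth of the bottom row\<close>

text \<open>For coprime positive arguments this is the sum of the partial quotients of \<open>p / q\<close>, one more than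
  the depth of the pair in the Calkin--Wilf tree.\<close>

function euclid_length :: "nat \<Rightarrow> nat \<Rightarrow> nat" where
  "euclid_length p q = (if p = 0 \<or> q = 0 then 0
     else if q \<le> p then Suc (euclid_length (p - q) q) else Suc (euclid_length p (q - p)))"
  by auto
termination by (relation "Wellfounded.measure (\<lambda>(p, q). p + q)") auto

declare euclid_length.simps [simp del]

lemma euclid_length_0 [simp]: "euclid_length 0 q = 0" "euclid_length p 0 = 0"
  by (simp_all add: euclid_length.simps)

lemma euclid_length_add: "q > 0 \<Longrightarrow> euclid_length (p + q) q = Suc (euclid_length p q)"
  by (subst euclid_length.simps) simp

lemma euclid_length_commute: "euclid_length p q = euclid_length q p"
proof (induction p q rule: euclid_length.induct)
  case (1 p q)
  show ?case
  proof (cases "p = 0 \<or> q = 0 \<or> p = q")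
    case True
    then show ?thesis by auto
  next
    case False
    then show ?thesis
      using 1 by (subst (1 2) euclid_length.simps) auto
  qed
qed

lemma euclid_length_add': "p > 0 \<Longrightarrow> euclid_length p (p + q) = Suc (euclid_length p q)"
  using euclid_length_add [of p q] by (metis add.commute euclid_length_commute)

lemma euclid_length_le: "euclid_length p q \<le> p + q"
  by (induction p q rule: euclid_length.induct) (subst euclid_length.simps, auto)

lemma euclid_length_pos: "p > 0 \<Longrightarrow> q > 0 \<Longrightarrow> euclid_length p q > 0"
  by (subst euclid_length.simps) simp

text \<open>The inverse of the depth decreases along the drift by about the inverse square of the depth.
  Level 1, where the two moves towards the root are as likely as the two moves away from it, needs
  the value at level 0 to lie below \<open>2 / 4 - 1 / 5\<close>, and level 0 needs it to exceed \<open>1 / 4\<close>; the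
  number \<open>17 / 60\<close> lies between.\<close>

definition level_potential :: "nat \<Rightarrow> real" where
  "level_potential l = (if l = 0 then 17 / 60 else 1 / (real l + 3))"

abbreviation pair_potential :: "nat \<Rightarrow> nat \<Rightarrow> real" where
  "pair_potential p q \<equiv> level_potential (euclid_length p q)"

text \<open>Of the four moves from an inner pair two lead to its children, one to its parent and one to its
  sibling. The pairs \<open>(1, 0)\<close> and \<open>(1, 1)\<close> are degenerate and are computed directly.\<close>

lemma pair_potential_drift:
  assumes "coprime p q" "q \<le> p"
  shows "2 * (pair_potential p (p + q) + pair_potential p (p - q) +
      pair_potential q (p + q) + pair_potential q (p - q)) + 1 / (2 * (real (euclid_length p q) + 3)\<^sup>2)
    \<le> 8 * pair_potential p q"
proof -
  consider "q = 0" | "q > 0" "p = q" | "q > 0" "q < p" using assms(2) by linarith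
  then show ?thesis
  proof cases
    case 1
    then have "p = 1" using assms by simp
    moreover have "euclid_length 1 1 = Suc 0" by (subst euclid_length.simps) simp
    ultimately show ?thesis using 1 by (simp add: level_potential_def)
  next
    case 2
    then have "p = 1" using assms by simp
    moreover have "euclid_length 1 1 = Suc 0" by (subst euclid_length.simps) simp
    moreover have "euclid_length 1 2 = Suc (euclid_length 1 1)"
      using euclid_length_add' [of 1 1] by (simp add: numeral_2_eq_2)
    ultimately show ?thesis using 2 by (simp add: level_potential_def power2_eq_square numeral_2_eq_2)
  next
    case 3
    define l where "l = euclid_length q (p - q)"
    have l: "l > 0" using 3 by (simp add: l_def euclid_length_pos)
    have L: "euclid_length p q = Suc l"
      using euclid_length_add' [of q "p - q"] 3 by (simp add: l_def euclid_length_commute [of p q])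
    have "euclid_length p (p + q) = Suc (Suc l)"
      using euclid_length_add' [of p q] 3 L by simp
    moreover have "euclid_length q (p + q) = Suc (Suc l)"
      using euclid_length_add' [of q p] 3 L by (simp add: add.commute euclid_length_commute [of q p])
    moreover have "euclid_length p (p - q) = Suc l"
      using euclid_length_add [of "p - q" q] 3 by (simp add: l_def)
    moreover have "euclid_length q (p - q) = l" by (simp add: l_def)
    moreover define m where "m = real l + 4"
    have m: "m \<ge> 5" using l by (simp add: m_def)
    have "2 * (1 / (m + 1) + 1 / m + 1 / (m + 1) + 1 / (m - 1)) + 1 / (2 * m\<^sup>2) \<le> 8 * (1 / m)"
    proof -
      have nz: "m \<noteq> 0" "m + 1 \<noteq> 0" "m - 1 \<noteq> 0" using m by auto
      have "8 * (1 / m) - (2 * (1 / (m + 1) + 1 / m + 1 / (m + 1) + 1 / (m - 1)) + 1 / (2 * m\<^sup>2)) =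
          (3 * m * (m - 4) + 1) / (2 * m\<^sup>2 * (m + 1) * (m - 1))"
        using nz by (simp add: divide_simps power2_eq_square) (simp add: algebra_simps)
      moreover have "3 * m * (m - 4) + 1 \<ge> 0" using m by (intro add_nonneg_nonneg mult_nonneg_nonneg) auto
      moreover have "2 * m\<^sup>2 * (m + 1) * (m - 1) \<ge> 0" using m by (intro mult_nonneg_nonneg) auto
      ultimately show ?thesis by (smt (verit) divide_nonneg_nonneg)
    qed
    ultimately show ?thesis
      using l L by (simp add: level_potential_def m_def algebra_simps)
  qed
qed

definition row_potential :: "int \<Rightarrow> int \<Rightarrow> real" where
  "row_potential c d = pair_potential (nat \<bar>c\<bar>) (nat \<bar>d\<bar>)"

lemma row_potential_sign: "row_potential (- c) d = row_potential c d" "row_potential c (- d) = row_potential c d"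
  by (simp_all add: row_potential_def)

lemma row_potential_commute: "row_potential c d = row_potential d c"
  by (simp add: row_potential_def euclid_length_commute)

text \<open>The depth is at most the sum of the entries, so the decrease of the potential controls the inverse
  of the squared norm of the row.\<close>

lemma row_potential_drift:
  assumes "coprime c d"
  shows "2 * (row_potential c (c + d) + row_potential c (c - d) +
      row_potential d (c + d) + row_potential d (c - d)) + 1 / (64 * of_int (c\<^sup>2 + d\<^sup>2))
    \<le> 8 * row_potential c d"
proof -
  have main: "2 * (row_potential c (c + d) + row_potential c (c - d) +
      row_potential d (c + d) + row_potential d (c - d)) + 1 / (64 * of_int (c\<^sup>2 + d\<^sup>2))
    \<le> 8 * row_potential c d" if cop: "coprime c d" and cd: "\<bar>d\<bar> \<le> \<bar>c\<bar>" for c d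
  proof -
    define p q where "p = nat \<bar>c\<bar>" and "q = nat \<bar>d\<bar>"
    have pq: "coprime p q" "q \<le> p" using cop cd by (auto simp: p_def q_def)
    have "\<bar>c + d\<bar> = \<bar>c\<bar> + \<bar>d\<bar> \<and> \<bar>c - d\<bar> = \<bar>c\<bar> - \<bar>d\<bar> \<or> \<bar>c + d\<bar> = \<bar>c\<bar> - \<bar>d\<bar> \<and> \<bar>c - d\<bar> = \<bar>c\<bar> + \<bar>d\<bar>"
      using cd by linarith
    moreover have nats: "nat (\<bar>c\<bar> + \<bar>d\<bar>) = p + q" "nat (\<bar>c\<bar> - \<bar>d\<bar>) = p - q"
      by (auto simp: p_def q_def nat_add_distrib nat_diff_distrib')
    ultimately have sum: "row_potential c (c + d) + row_potential c (c - d) +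
        row_potential d (c + d) + row_potential d (c - d) =
        pair_potential p (p + q) + pair_potential p (p - q) + pair_potential q (p + q) + pair_potential q (p - q)"
      unfolding row_potential_def by (auto simp flip: p_def q_def)
    have pos: "p + q > 0" using pq(1) by (cases "p = 0") auto
    define l where "l = euclid_length p q"
    have "l + 3 \<le> 4 * (p + q)"
      using euclid_length_le [of p q] Suc_leI [OF pos] by (simp add: l_def)
    then have "real (l + 3) \<le> real (4 * (p + q))" by (simp only: of_nat_le_iff)
    then have "real l + 3 \<le> 4 * (real p + real q)" by simp
    then have "(real l + 3)\<^sup>2 \<le> (4 * (real p + real q))\<^sup>2" by (intro power_mono) auto
    also have "\<dots> \<le> 32 * ((real p)\<^sup>2 + (real q)\<^sup>2)"
      using sum_squares_ge_zero [of "real p - real q" 0] by (simp add: power2_eq_square algebra_simps)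
    also have "(real p)\<^sup>2 + (real q)\<^sup>2 = of_int (c\<^sup>2 + d\<^sup>2)"
      by (simp add: p_def q_def)
    finally have le: "2 * (real l + 3)\<^sup>2 \<le> 64 * of_int (c\<^sup>2 + d\<^sup>2)" by simp
    have l0: "0 < 2 * (real l + 3)\<^sup>2" by (intro mult_pos_pos zero_less_power) simp_all
    have "1 / (64 * of_int (c\<^sup>2 + d\<^sup>2)) \<le> 1 / (2 * (real l + 3)\<^sup>2)"
      by (intro divide_left_mono [OF le] mult_pos_pos [OF less_le_trans [OF l0 le] l0]) simp
    then show ?thesis
      using pair_potential_drift [OF pq] unfolding sum l_def by (simp add: row_potential_def flip: p_def q_def)
  qed
  show ?thesis
  proof (cases "\<bar>d\<bar> \<le> \<bar>c\<bar>")
    case True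
    then show ?thesis using main assms by blast
  next
    case False
    have "row_potential x (d - c) = row_potential x (c - d)" for x
      using row_potential_sign(2) [of x "c - d"] by simp
    then show ?thesis
      using main [of d c] False assms
      by (simp add: coprime_commute add.commute [of d c] add.commute [of "d\<^sup>2" "c\<^sup>2"] row_potential_commute [of d c])
  qed
qed

lift_definition bottom_norm :: "psl2z \<Rightarrow> int" is "\<lambda>A. (A$2$1)\<^sup>2 + (A$2$2)\<^sup>2"
  by auto

lift_definition bottom_potential :: "psl2z \<Rightarrow> real" is "\<lambda>A. row_potential (A$2$1) (A$2$2)"
  by (auto simp: row_potential_sign)

lemma bottom_norm_of: "a * d - b * c = 1 \<Longrightarrow> bottom_norm (psl2z_of a b c d) = c\<^sup>2 + d\<^sup>2"
  by (subst bottom_norm.abs_eq) (auto simp: sl2z_def det_2)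

lemma bottom_potential_of: "a * d - b * c = 1 \<Longrightarrow> bottom_potential (psl2z_of a b c d) = row_potential c d"
  by (subst bottom_potential.abs_eq) (auto simp: sl2z_def det_2)

lemma bottom_norm_pos: "bottom_norm A > 0"
proof -
  obtain a b c d where "A = psl2z_of a b c d" "a * d - b * c = 1" by (rule psl2z_exhaust)
  then show ?thesis by (auto simp: bottom_norm_of sum_power2_gt_zero_iff)
qed

lemma bottom_potential_bounds: "0 \<le> bottom_potential A" "bottom_potential A \<le> 1"
  by (transfer, simp add: row_potential_def level_potential_def)+

lemma bottom_potential_drift:
  "(\<Sum>s\<in>steps. bottom_potential (A * s)) + 1 / (64 * of_int (bottom_norm A)) \<le> 9 * bottom_potential A"
proof -
  obtain a b c d where A: "A = psl2z_of a b c d" and det: "a * d - b * c = 1" by (rule psl2z_exhaust)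
  have row: "bottom_potential (psl2z_of a b c d * psl2z_of a' b' c' d') =
      row_potential (c * a' + d * c') (c * b' + d * d')" if det': "a' * d' - b' * c' = 1" for a' b' c' d'
  proof -
    have "(a * a' + b * c') * (c * b' + d * d') - (a * b' + b * d') * (c * a' + d * c') =
        (a * d - b * c) * (a' * d' - b' * c')" by algebra
    then show ?thesis by (simp add: psl2z_of_mult [OF det det'] bottom_potential_of det det')
  qed
  have sym: "row_potential (- x) y = row_potential x y" "row_potential x (- y) = row_potential x y"
    "row_potential (d - c) x = row_potential x (c - d)" "row_potential (c + d) x = row_potential x (c + d)"
    "row_potential x (d - c) = row_potential x (c - d)" "row_potential (c - d) x = row_potential x (c - d)"
    "row_potential d c = row_potential c d" for x y
    using row_potential_sign [of "c - d" x] row_potential_sign [of x "c - d"]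
    by (simp_all add: row_potential_sign row_potential_commute [of _ x] row_potential_commute [of d c])
  have "coprime c d"
  proof (rule coprimeI)
    fix g assume "g dvd c" "g dvd d"
    then have "g dvd a * d - b * c" by (intro dvd_diff dvd_mult)
    then show "is_unit g" by (simp add: det)
  qed
  from row_potential_drift [OF this] show ?thesis
    unfolding A steps_eq
    by (simp add: psl2z_of_eq_iff row bottom_potential_of det bottom_norm_of sym)
qed

section \<open>Convergence along one trajectory\<close>

text \<open>The quadratic form \<open>cmod (c * z + d)\<close> squared in \<open>(c, d)\<close> has determinant \<open>(Im z)\<^sup>2\<close> and trace
  \<open>1 + (cmod z)\<^sup>2\<close>, and its smallest eigenvalue is at least their quotient.\<close>

lemma denom_lower_bound:
  assumes "Im z > 0"
  shows "\<exists>\<kappa>>0. \<forall>c d :: int. \<kappa> * of_int (c\<^sup>2 + d\<^sup>2) \<le> (cmod (of_int c * z + of_int d))\<^sup>2"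
proof (intro exI conjI allI)
  let ?r = "(cmod z)\<^sup>2" and ?k = "(Im z)\<^sup>2 / (1 + (cmod z)\<^sup>2)"
  have pos: "1 + ?r > 0" by (simp add: add_pos_nonneg)
  then show "?k > 0" using assms by simp
  fix c d :: int
  have "(cmod (of_int c * z + of_int d))\<^sup>2 * (1 + ?r) - (Im z)\<^sup>2 * of_int (c\<^sup>2 + d\<^sup>2) =
      (of_int c * Re z + of_int d)\<^sup>2 + (of_int c * ?r + of_int d * Re z)\<^sup>2"
    unfolding cmod_power2 by (simp add: power2_eq_square algebra_simps)
  moreover have "\<dots> \<ge> 0" by simp
  ultimately have "(Im z)\<^sup>2 * of_int (c\<^sup>2 + d\<^sup>2) \<le> (cmod (of_int c * z + of_int d))\<^sup>2 * (1 + ?r)"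
    by linarith
  then show "?k * of_int (c\<^sup>2 + d\<^sup>2) \<le> (cmod (of_int c * z + of_int d))\<^sup>2"
    using pos by (simp add: pos_divide_le_eq mult.commute)
qed

lemma mobius_diff:
  assumes det: "a * d - b * c = 1" and "of_int c * z + of_int d \<noteq> 0" "of_int c * w + of_int d \<noteq> 0"
  shows "mobius (psl2z_of a b c d) z - mobius (psl2z_of a b c d) w =
    (z - w) / ((of_int c * z + of_int d) * (of_int c * w + of_int d))"
proof -
  have "(of_int a * z + of_int b) * (of_int c * w + of_int d) - (of_int a * w + of_int b) * (of_int c * z + of_int d) =
      of_int (a * d - b * c) * (z - w)" by (simp add: algebra_simps)
  then show ?thesis
    using assms by (simp add: mobius_of diff_frac_eq)
qed

lemma mobius_close:
  assumes "Im z > 0" "Im w > 0"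
  shows "\<exists>K. \<forall>A. cmod (mobius A z - mobius A w) \<le> K / of_int (bottom_norm A)"
proof -
  obtain k where k: "k > 0" "\<And>c d :: int. k * of_int (c\<^sup>2 + d\<^sup>2) \<le> (cmod (of_int c * z + of_int d))\<^sup>2"
    using denom_lower_bound [OF assms(1)] by blast
  obtain l where l: "l > 0" "\<And>c d :: int. l * of_int (c\<^sup>2 + d\<^sup>2) \<le> (cmod (of_int c * w + of_int d))\<^sup>2"
    using denom_lower_bound [OF assms(2)] by blast
  have "cmod (mobius A z - mobius A w) \<le> cmod (z - w) / sqrt (k * l) / of_int (bottom_norm A)" for A
  proof -
    obtain a b c d where A: "A = psl2z_of a b c d" and det: "a * d - b * c = 1" by (rule psl2z_exhaust)
    let ?u = "of_int c * z + of_int d" and ?v = "of_int c * w + of_int d"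
    let ?n = "real_of_int (c\<^sup>2 + d\<^sup>2)"
    have n: "?n > 0"
      using bottom_norm_pos [of A] unfolding of_int_0_less_iff A bottom_norm_of [OF det] .
    have nz: "?u \<noteq> 0" "?v \<noteq> 0" using denom_nonzero [OF det] assms by auto
    have "sqrt (k * l) * ?n = sqrt (k * ?n) * sqrt (l * ?n)"
      using n by (simp add: real_sqrt_mult)
    also have "\<dots> \<le> cmod ?u * cmod ?v"
      using k(2) [of c d] l(2) [of c d] k(1) l(1) n by (intro mult_mono real_le_lsqrt) (auto intro: real_sqrt_le_mono)
    finally have le: "sqrt (k * l) * ?n \<le> cmod ?u * cmod ?v" .
    have "cmod (mobius A z - mobius A w) = cmod (z - w) / (cmod ?u * cmod ?v)"
      unfolding A mobius_diff [OF det nz] by (simp add: norm_divide norm_mult)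
    also have "\<dots> \<le> cmod (z - w) / (sqrt (k * l) * ?n)"
      using le k(1) l(1) n nz by (intro divide_left_mono mult_pos_pos) auto
    finally show ?thesis by (simp add: A bottom_norm_of [OF det])
  qed
  then show ?thesis by blast
qed

lemma walk_converges:
  fixes A s :: "nat \<Rightarrow> psl2z"
  assumes z: "Im z > 0" and step: "\<And>n. A (Suc n) = A n * s n" "\<And>n. s n \<in> steps"
    and sum: "summable (\<lambda>n. 1 / real_of_int (bottom_norm (A n)))"
  shows "\<exists>x. (\<lambda>n. mobius (A n) z) \<longlonglongrightarrow> complex_of_real x"
proof -
  let ?N = "\<lambda>n. real_of_int (bottom_norm (A n))" and ?V = "\<lambda>n. mobius (A n) z"
  have Npos: "?N n > 0" for n using bottom_norm_pos by simp
  have "\<exists>K. \<forall>A. cmod (mobius A (mobius t z) - mobius A z) \<le> K / of_int (bottom_norm A)" for t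
    by (rule mobius_close [OF mobius_upper [OF z] z])
  then obtain K where K: "cmod (mobius A (mobius t z) - mobius A z) \<le> K t / of_int (bottom_norm A)" for t A
    by metis
  define C where "C = (\<Sum>t\<in>steps. \<bar>K t\<bar>)"
  have fin: "finite steps" by (simp add: steps_eq)
  have "norm (?V (Suc n) - ?V n) \<le> C * (1 / ?N n)" for n
  proof -
    have "norm (?V (Suc n) - ?V n) \<le> K (s n) / ?N n"
      using K [of "A n" "s n"] by (simp add: step(1) mobius_mult_upper [OF z])
    also have "\<bar>K (s n)\<bar> \<le> C"
      unfolding C_def by (rule member_le_sum) (use step(2) fin in auto)
    then have "K (s n) / ?N n \<le> C / ?N n" using Npos [of n] by (intro divide_right_mono) auto
    finally show ?thesis by simp
  qed
  then have "summable (\<lambda>n. ?V (Suc n) - ?V n)"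
    by (intro summable_comparison_test' [OF summable_mult [OF sum]]) auto
  then have "convergent (\<lambda>n. \<Sum>i<n. ?V (Suc i) - ?V i)"
    by (simp add: summable_iff_convergent)
  then have "convergent (\<lambda>n. ?V n - ?V 0)" by (simp only: sum_lessThan_telescope [of ?V])
  then have "convergent (\<lambda>n. (?V n - ?V 0) + ?V 0)" by (intro convergent_add convergent_const)
  then obtain L where L: "?V \<longlonglongrightarrow> L" by (auto simp: convergent_def)
  obtain k where k: "k > 0" "\<And>c d :: int. k * of_int (c\<^sup>2 + d\<^sup>2) \<le> (cmod (of_int c * z + of_int d))\<^sup>2"
    using denom_lower_bound [OF z] by blast
  have Im_le: "\<bar>Im (?V n)\<bar> \<le> Im z / k * (1 / ?N n)" for n
  proof -
    obtain a b c d where A: "A n = psl2z_of a b c d" and det: "a * d - b * c = 1" by (rule psl2z_exhaust)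
    have pos: "k * ?N n > 0" using k(1) Npos by simp
    have le: "k * ?N n \<le> (cmod (of_int c * z + of_int d))\<^sup>2"
      using k(2) [of c d] unfolding A bottom_norm_of [OF det] .
    have "Im z / (cmod (of_int c * z + of_int d))\<^sup>2 \<le> Im z / (k * ?N n)"
      by (intro divide_left_mono [OF le] mult_pos_pos [OF less_le_trans [OF pos le] pos]) (use z in simp)
    then show ?thesis using z by (simp add: A Im_mobius [OF det])
  qed
  have "(\<lambda>n. Im (?V n)) \<longlonglongrightarrow> 0"
  proof (rule Lim_null_comparison)
    show "\<forall>\<^sub>F n in sequentially. norm (Im (?V n)) \<le> Im z / k * (1 / ?N n)"
      using Im_le by simp
    show "(\<lambda>n. Im z / k * (1 / ?N n)) \<longlonglongrightarrow> 0"
      by (rule tendsto_mult_right_zero) (rule summable_LIMSEQ_zero [OF sum])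
  qed
  then have "Im L = 0" using tendsto_Im [OF L] LIMSEQ_unique by blast
  then have "L = of_real (Re L)" by (simp add: complex_eq_iff)
  then show ?thesis using L by metis
qed

lemma LIMSEQ_subseq_criterion:
  fixes X :: "nat \<Rightarrow> 'a :: metric_space"
  assumes "\<And>r :: nat \<Rightarrow> nat. strict_mono r \<Longrightarrow> \<exists>q. strict_mono q \<and> (\<lambda>n. X (r (q n))) \<longlonglongrightarrow> l"
  shows "X \<longlonglongrightarrow> l"
proof (rule ccontr)
  assume "\<not> X \<longlonglongrightarrow> l"
  then obtain e where e: "e > 0" "\<not> (\<forall>\<^sub>F n in sequentially. dist (X n) l < e)"
    by (auto simp: tendsto_iff)
  then have "infinite {n. dist (X n) l \<ge> e}"
    by (simp add: not_eventually not_less frequently_cofinite flip: cofinite_eq_sequentially)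
  then obtain r :: "nat \<Rightarrow> nat" where r: "strict_mono r" "\<And>n. dist (X (r n)) l \<ge> e"
    using infinite_enumerate by blast
  obtain q where "(\<lambda>n. X (r (q n))) \<longlonglongrightarrow> l" using assms [OF r(1)] by blast
  then have "\<forall>\<^sub>F n in sequentially. dist (X (r (q n))) l < e" using e(1) by (auto simp: tendsto_iff)
  then show False using r(2) by (auto simp: eventually_sequentially not_less [symmetric])
qed

text \<open>Away from the pole of \<open>A n\<close>, the image of a real point is close to the image of \<open>z\<close>. The poles need
  not converge, but along a subsequence the directions of the bottom rows do. For such a
  subsequence every point other than the limiting pole is attracted to \<open>x\<close>, and the limiting pole
  carries no mass. The limit is the same for every subsequence.\<close>

lemma pushforward_concentrates:
  fixes A :: "nat \<Rightarrow> psl2z"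
  assumes z: "Im z > 0" and lim: "(\<lambda>n. mobius (A n) z) \<longlonglongrightarrow> complex_of_real x"
    and norm: "(\<lambda>n. 1 / real_of_int (bottom_norm (A n))) \<longlonglongrightarrow> 0"
  shows "(\<lambda>n. \<integral>y. iexp (t * real_mobius (A n) y) \<partial>signed_minkowski) \<longlonglongrightarrow> iexp (t * x)"
proof (rule LIMSEQ_subseq_criterion)
  fix r :: "nat \<Rightarrow> nat" assume r: "strict_mono r"
  interpret mu: real_distribution signed_minkowski by (rule real_distribution_signed_minkowski)
  have "\<exists>a b c d. A n = psl2z_of a b c d \<and> a * d - b * c = 1" for n
    using psl2z_exhaust by metis
  then obtain a b c d where A: "\<And>n. A n = psl2z_of (a n) (b n) (c n) (d n)"
    and det: "\<And>n. a n * d n - b n * c n = 1" by metis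
  define N where "N = (\<lambda>n. real_of_int (bottom_norm (A n)))"
  have N: "N n = (of_int (c n))\<^sup>2 + (of_int (d n))\<^sup>2" for n
    by (simp add: N_def A bottom_norm_of [OF det])
  have Npos: "N n > 0" for n using bottom_norm_pos [of "A n"] by (simp add: N_def)
  \<comment> \<open>The normalised bottom rows lie on the unit circle; a limit of them is the only direction
    whose point on the real line may fail to be contracted.\<close>
  define w where "w = (\<lambda>n. Complex (of_int (c n)) (of_int (d n)) / of_real (sqrt (N n)))"
  have "cmod (Complex (of_int (c n)) (of_int (d n))) = sqrt (N n)" for n
    by (simp add: cmod_def N)
  then have "w n \<in> sphere 0 1" for n
    using Npos [of n] by (simp add: w_def norm_divide)
  then have "\<forall>n. w (r n) \<in> sphere 0 1" by blast
  from seq_compactE [OF compact_imp_seq_compact [OF compact_sphere] this]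
  obtain q v where q: "strict_mono q" and v: "v \<in> sphere 0 1" "(\<lambda>n. w (r (q n))) \<longlonglongrightarrow> v"
    unfolding comp_def by blast
  define g where "g = (\<lambda>n. r (q n))"
  have g: "strict_mono g" using r q by (simp add: g_def strict_mono_def)
  obtain k where k: "k > 0" "\<And>c d :: int. k * of_int (c\<^sup>2 + d\<^sup>2) \<le> (cmod (of_int c * z + of_int d))\<^sup>2"
    using denom_lower_bound [OF z] by blast
  have pointwise: "(\<lambda>n. real_mobius (A (g n)) y) \<longlonglongrightarrow> x" if y: "Re v * y + Im v \<noteq> 0" for y
  proof -
    let ?l = "\<lambda>n. \<bar>Re (w (g n)) * y + Im (w (g n))\<bar>"
    have wl: "?l \<longlonglongrightarrow> \<bar>Re v * y + Im v\<bar>"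
      using v(2) unfolding g_def by (intro tendsto_intros)
    have close: "norm (real_mobius (A n) y - Re (mobius (A n) z)) \<le>
        cmod (of_real y - z) / sqrt k * (1 / \<bar>Re (w n) * y + Im (w n)\<bar>) * (1 / N n)"
      if nz: "Re (w n) * y + Im (w n) \<noteq> 0" for n
    proof -
      have den: "of_int (c n) * y + of_int (d n) = sqrt (N n) * (Re (w n) * y + Im (w n))"
        using Npos [of n] by (simp add: w_def field_simps)
      then have "of_int (c n) * y + of_int (d n) \<noteq> 0" using nz Npos [of n] by simp
      then have nz1: "of_int (c n) * complex_of_real y + of_int (d n) \<noteq> 0"
        by (metis of_real_add of_real_eq_0_iff of_real_mult of_real_of_int_eq)
      have nz2: "of_int (c n) * z + of_int (d n) \<noteq> 0" by (rule denom_nonzero [OF det z])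
      have norm_u: "cmod (of_int (c n) * complex_of_real y + of_int (d n)) =
          sqrt (N n) * \<bar>Re (w n) * y + Im (w n)\<bar>"
      proof -
        have "of_int (c n) * complex_of_real y + of_int (d n) = of_real (of_int (c n) * y + of_int (d n))"
          by simp
        then show ?thesis using Npos [of n] by (simp only: norm_of_real den abs_mult) simp
      qed
      have le: "sqrt k * sqrt (N n) \<le> cmod (of_int (c n) * z + of_int (d n))"
        using k(2) [of "c n" "d n"] by (simp add: N real_le_lsqrt flip: real_sqrt_mult)
      have "norm (real_mobius (A n) y - Re (mobius (A n) z)) \<le>
          cmod (mobius (A n) (of_real y) - mobius (A n) z)"
        using abs_Re_le_cmod [of "mobius (A n) (of_real y) - mobius (A n) z"]
        by (simp add: real_mobius_def)
      also have "\<dots> = cmod (of_real y - z) /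
          (sqrt (N n) * \<bar>Re (w n) * y + Im (w n)\<bar> * cmod (of_int (c n) * z + of_int (d n)))"
        unfolding A mobius_diff [OF det nz1 nz2] by (simp add: norm_divide norm_mult norm_u)
      also have "\<dots> \<le> cmod (of_real y - z) /
          (sqrt (N n) * \<bar>Re (w n) * y + Im (w n)\<bar> * (sqrt k * sqrt (N n)))"
        using le nz nz2 Npos [of n] k(1)
        by (intro divide_left_mono mult_left_mono mult_pos_pos) auto
      also have "\<dots> = cmod (of_real y - z) / sqrt k * (1 / \<bar>Re (w n) * y + Im (w n)\<bar>) * (1 / N n)"
        using Npos [of n] by (simp add: field_simps)
      finally show ?thesis .
    qed
    have "(\<lambda>n. real_mobius (A (g n)) y - Re (mobius (A (g n)) z)) \<longlonglongrightarrow> 0"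
    proof (rule Lim_null_comparison)
      have "\<forall>\<^sub>F n in sequentially. ?l n > 0"
        using order_tendstoD(1) [OF wl, of 0] y by simp
      then show "\<forall>\<^sub>F n in sequentially. norm (real_mobius (A (g n)) y - Re (mobius (A (g n)) z)) \<le>
          cmod (of_real y - z) / sqrt k * (1 / ?l n) * (1 / N (g n))"
        by eventually_elim (rule close, simp)
      have "(\<lambda>n. 1 / N (g n)) \<longlonglongrightarrow> 0"
        using LIMSEQ_subseq_LIMSEQ [OF norm g] by (simp add: N_def comp_def)
      then have "(\<lambda>n. cmod (of_real y - z) / sqrt k * (1 / ?l n) * (1 / N (g n))) \<longlonglongrightarrow>
          cmod (of_real y - z) / sqrt k * (1 / \<bar>Re v * y + Im v\<bar>) * 0"
        using y by (intro tendsto_mult tendsto_divide tendsto_const wl) auto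
      then show "(\<lambda>n. cmod (of_real y - z) / sqrt k * (1 / ?l n) * (1 / N (g n))) \<longlonglongrightarrow> 0" by simp
    qed
    moreover have "(\<lambda>n. Re (mobius (A (g n)) z)) \<longlonglongrightarrow> x"
      using tendsto_Re [OF LIMSEQ_subseq_LIMSEQ [OF lim g]] by (simp add: comp_def)
    ultimately show ?thesis using tendsto_add [of _ 0 _ _ x] by fastforce
  qed
  have AE_lim: "AE y in signed_minkowski. (\<lambda>n. real_mobius (A (g n)) y) \<longlonglongrightarrow> x"
    using AE_signed_minkowski_neq [of "- Im v / Re v"]
  proof eventually_elim
    case (elim y)
    have "Re v * y + Im v \<noteq> 0"
    proof
      assume *: "Re v * y + Im v = 0"
      show False
      proof (cases "Re v = 0")
        case True
        then have "v = 0" using * by (simp add: complex_eq_iff)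
        then show False using v(1) by simp
      next
        case False
        then have "y = - Im v / Re v" using * by (simp add: field_simps)
        then show False using elim by simp
      qed
    qed
    then show ?case by (rule pointwise)
  qed
  have "(\<lambda>n. \<integral>y. iexp (t * real_mobius (A (g n)) y) \<partial>signed_minkowski) \<longlonglongrightarrow>
      (\<integral>y. iexp (t * x) \<partial>signed_minkowski)"
  proof (intro integral_dominated_convergence [where w = "\<lambda>_. 1"])
    show "AE y in signed_minkowski. (\<lambda>n. iexp (t * real_mobius (A (g n)) y)) \<longlonglongrightarrow> iexp (t * x)"
      using AE_lim by eventually_elim (intro tendsto_intros)
  qed auto
  also have "(\<integral>y. iexp (t * x) \<partial>signed_minkowski) = iexp (t * x)"
    using mu.prob_space by simp
  finally have "(\<lambda>n. \<integral>y. iexp (t * real_mobius (A (r (q n))) y) \<partial>signed_minkowski) \<longlonglongrightarrow> iexp (t * x)"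
    by (simp only: g_def)
  then show "\<exists>q. strict_mono q \<and>
      (\<lambda>n. \<integral>y. iexp (t * real_mobius (A (r (q n))) y) \<partial>signed_minkowski) \<longlonglongrightarrow> iexp (t * x)"
    using q by blast
qed

section \<open>The random walk\<close>

definition words :: "nat \<Rightarrow> psl2z list set" where
  "words n = {l. set l \<subseteq> steps \<and> length l = n}"

lemma finite_steps: "finite steps"
  by (simp add: steps_eq)

lemma finite_words: "finite (words n)"
  unfolding words_def using finite_steps by (rule finite_lists_length_eq)

lemma words_0: "words 0 = {[]}"
  by (auto simp: words_def)

lemma sum_words_Suc: "(\<Sum>l\<in>words (Suc n). f l) = (\<Sum>l\<in>words n. \<Sum>s\<in>steps. f (l @ [s]))"
proof -
  have "words (Suc n) = (\<lambda>(l, s). l @ [s]) ` (words n \<times> steps)"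
  proof (intro set_eqI iffI)
    fix l assume l: "l \<in> words (Suc n)"
    then have "l \<noteq> []" by (auto simp: words_def)
    then have "l = butlast l @ [last l]" by simp
    moreover have "set (butlast l) \<subseteq> set l" "last l \<in> set l"
      using \<open>l \<noteq> []\<close> by (auto dest: in_set_butlastD)
    then have "butlast l \<in> words n" "last l \<in> steps" using l by (auto simp: words_def)
    ultimately show "l \<in> (\<lambda>(l, s). l @ [s]) ` (words n \<times> steps)" by force
  qed (auto simp: words_def)
  moreover have "inj_on (\<lambda>(l, s). l @ [s]) (words n \<times> steps)" by (auto simp: inj_on_def)
  ultimately show ?thesis
    by (simp add: sum.reindex sum.cartesian_product case_prod_unfold comp_def)
qed

lemma foldr_mobius:
  assumes "Im z > 0"
  shows "foldr (\<lambda>k. mobius (M k)) ks z = mobius (prod_list (map M ks)) z"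
  by (induction ks) (simp_all add: mobius_one mobius_mult_upper [OF assms])

locale uniform_walk = prob_space P for P :: "'a measure" +
  fixes M :: "nat \<Rightarrow> 'a \<Rightarrow> psl2z"
  assumes indep: "indep_vars (\<lambda>_. count_space UNIV) M {1..}"
    and law: "\<And>k. k \<ge> 1 \<Longrightarrow> distr P (count_space UNIV) (M k) = measure_pmf (pmf_of_set steps)"
begin

lemma measurable_M: "k \<ge> 1 \<Longrightarrow> M k \<in> measurable P (count_space UNIV)"
  using indep by (auto simp: indep_vars_def)

lemma prob_M:
  assumes "k \<ge> 1"
  shows "prob (M k -` {s} \<inter> space P) = (if s \<in> steps then 1 / 9 else 0)"
proof -
  have "prob (M k -` {s} \<inter> space P) = measure (distr P (count_space UNIV) (M k)) {s}"
    by (rule measure_distr [symmetric]) (use measurable_M [OF assms] in auto)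
  also have "\<dots> = pmf (pmf_of_set steps) s"
    unfolding law [OF assms] by (rule measure_pmf_single)
  also have "\<dots> = (if s \<in> steps then 1 / 9 else 0)"
    using finite_steps card_steps by (subst pmf_of_set) (auto simp: indicator_def)
  finally show ?thesis .
qed

lemma AE_M: "AE \<omega> in P. \<forall>k\<ge>1. M k \<omega> \<in> steps"
proof -
  have "AE \<omega> in P. M k \<omega> \<in> steps" if "k \<ge> 1" for k
  proof -
    have "AE s in distr P (count_space UNIV) (M k). s \<in> steps"
      unfolding law [OF that] using finite_steps by (subst AE_measure_pmf_iff) (simp add: steps_eq)
    then show ?thesis using measurable_M [OF that] by (simp add: AE_distr_iff)
  qed
  then show ?thesis by (simp add: AE_all_countable)
qed

definition walk_word :: "nat \<Rightarrow> 'a \<Rightarrow> psl2z list" where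
  "walk_word n \<omega> = map (\<lambda>k. M k \<omega>) [1..<Suc n]"

lemma length_walk_word [simp]: "length (walk_word n \<omega>) = n"
  by (simp add: walk_word_def)

lemma walk_word_0: "walk_word 0 \<omega> = []"
  by (simp add: walk_word_def)

lemma walk_word_Suc: "walk_word (Suc n) \<omega> = walk_word n \<omega> @ [M (Suc n) \<omega>]"
  by (simp add: walk_word_def)

lemma take_walk_word: "m \<le> n \<Longrightarrow> take m (walk_word n \<omega>) = walk_word m \<omega>"
  by (simp add: walk_word_def take_map take_upt del: upt_Suc)

lemma measurable_walk_word [measurable]: "walk_word n \<in> measurable P (count_space UNIV)"
proof (induction n)
  case 0
  then show ?case by (simp add: walk_word_0 [abs_def])
next
  case (Suc n)
  have "(\<lambda>\<omega>. l @ [M (Suc n) \<omega>]) \<in> measurable P (count_space UNIV)" for l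
    by (rule measurable_compose [OF measurable_M]) auto
  then show ?case
    unfolding walk_word_Suc [abs_def] by (rule measurable_compose_countable [OF _ Suc])
qed

lemma measurable_walk_word_compose [measurable]:
  "(\<lambda>\<omega>. f (walk_word n \<omega>)) \<in> borel_measurable P" for f :: "psl2z list \<Rightarrow> 'b :: topological_space"
  by (rule measurable_compose [OF measurable_walk_word]) simp

lemma AE_walk_word: "AE \<omega> in P. \<forall>n. walk_word n \<omega> \<in> words n"
  using AE_M by eventually_elim (auto simp: words_def walk_word_def)

lemma prob_walk_word:
  assumes "l \<in> words n"
  shows "prob {\<omega> \<in> space P. walk_word n \<omega> = l} = 1 / 9 ^ n"
proof (cases "n = 0")
  case True
  then show ?thesis using assms by (simp add: words_0 walk_word_0 prob_space)
next
  case False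
  have l: "length l = n" "set l \<subseteq> steps" using assms by (auto simp: words_def)
  have "{\<omega> \<in> space P. walk_word n \<omega> = l} = (\<Inter>i\<in>{1..n}. M i -` {l ! (i - 1)} \<inter> space P)"
  proof (intro set_eqI iffI)
    fix \<omega> assume "\<omega> \<in> {\<omega> \<in> space P. walk_word n \<omega> = l}"
    then show "\<omega> \<in> (\<Inter>i\<in>{1..n}. M i -` {l ! (i - 1)} \<inter> space P)"
      by (auto simp: walk_word_def nth_append simp del: upt_Suc)
  next
    fix \<omega> assume \<omega>: "\<omega> \<in> (\<Inter>i\<in>{1..n}. M i -` {l ! (i - 1)} \<inter> space P)"
    then have "walk_word n \<omega> = l"
      by (intro nth_equalityI) (auto simp: walk_word_def l simp del: upt_Suc)
    moreover have "\<omega> \<in> space P" using \<omega> False by auto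
    ultimately show "\<omega> \<in> {\<omega> \<in> space P. walk_word n \<omega> = l}" by simp
  qed
  also have "prob \<dots> = (\<Prod>i\<in>{1..n}. prob (M i -` {l ! (i - 1)} \<inter> space P))"
    by (rule indep_varsD [OF indep]) (use False in auto)
  also have "\<dots> = (\<Prod>i\<in>{1..n}. 1 / 9)"
  proof (rule prod.cong)
    fix i assume "i \<in> {1..n}"
    then have "l ! (i - 1) \<in> steps" using l nth_mem [of "i - 1" l] by auto
    then show "prob (M i -` {l ! (i - 1)} \<inter> space P) = 1 / 9"
      using \<open>i \<in> {1..n}\<close> by (simp add: prob_M)
  qed simp
  finally show ?thesis by (simp add: power_divide)
qed

text \<open>The first \<open>n\<close> steps are almost surely one of finitely many equally likely words, so all means of
  functions of them are finite averages, and no integrability questions arise.\<close>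

lemma integral_walk_word:
  fixes f :: "psl2z list \<Rightarrow> 'b :: {banach, second_countable_topology}"
  shows "integrable P (\<lambda>\<omega>. f (walk_word n \<omega>))"
    and "(\<integral>\<omega>. f (walk_word n \<omega>) \<partial>P) = (\<Sum>l\<in>words n. (1 / 9 ^ n) *\<^sub>R f l)"
proof -
  let ?E = "\<lambda>l. {\<omega> \<in> space P. walk_word n \<omega> = l}"
  have E: "?E l \<in> sets P" for l
    using measurable_sets [OF measurable_walk_word, of "{l}" n] by (simp add: vimage_def Int_def conj_commute)
  have int: "integrable P (\<lambda>\<omega>. indicator (?E l) \<omega> *\<^sub>R f l)" for l
    using E by (intro integrable_scaleR_left integrable_real_indicator) (auto simp: emeasure_eq_measure)
  have eq: "AE \<omega> in P. (\<Sum>l\<in>words n. indicator (?E l) \<omega> *\<^sub>R f l) = f (walk_word n \<omega>)"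
    using AE_walk_word AE_space
  proof eventually_elim
    case (elim \<omega>)
    have "(\<Sum>l\<in>words n. indicator (?E l) \<omega> *\<^sub>R f l) = (\<Sum>l\<in>words n. if walk_word n \<omega> = l then f l else 0)"
      by (rule sum.cong) (use elim in \<open>auto simp: indicator_def\<close>)
    also have "\<dots> = f (walk_word n \<omega>)" using elim finite_words by (simp add: sum.delta')
    finally show ?case .
  qed
  have "integrable P (\<lambda>\<omega>. \<Sum>l\<in>words n. indicator (?E l) \<omega> *\<^sub>R f l)"
    by (intro Bochner_Integration.integrable_sum int)
  then show "integrable P (\<lambda>\<omega>. f (walk_word n \<omega>))"
    by (subst (asm) integrable_cong_AE [OF _ _ eq]) auto
  have "(\<integral>\<omega>. f (walk_word n \<omega>) \<partial>P) = (\<integral>\<omega>. (\<Sum>l\<in>words n. indicator (?E l) \<omega> *\<^sub>R f l) \<partial>P)"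
    by (rule integral_cong_AE [symmetric]) (use eq int in \<open>auto intro!: borel_measurable_integrable Bochner_Integration.integrable_sum\<close>)
  also have "\<dots> = (\<Sum>l\<in>words n. \<integral>\<omega>. indicator (?E l) \<omega> *\<^sub>R f l \<partial>P)"
    by (rule Bochner_Integration.integral_sum) (rule int)
  also have "\<dots> = (\<Sum>l\<in>words n. (1 / 9 ^ n) *\<^sub>R f l)"
    by (rule sum.cong) (use E in \<open>simp_all add: prob_walk_word emeasure_eq_measure\<close>)
  finally show "(\<integral>\<omega>. f (walk_word n \<omega>) \<partial>P) = (\<Sum>l\<in>words n. (1 / 9 ^ n) *\<^sub>R f l)" .
qed

text \<open>The Markov property.\<close>

lemma expectation_walk_word_Suc:
  fixes f :: "psl2z list \<Rightarrow> 'b :: {banach, second_countable_topology}"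
  shows "(\<integral>\<omega>. f (walk_word (Suc n) \<omega>) \<partial>P) = (\<integral>\<omega>. (1 / 9) *\<^sub>R (\<Sum>s\<in>steps. f (walk_word n \<omega> @ [s])) \<partial>P)"
proof -
  have "(\<integral>\<omega>. f (walk_word (Suc n) \<omega>) \<partial>P) =
      (\<Sum>l\<in>words n. (1 / 9 ^ n) *\<^sub>R ((1 / 9) *\<^sub>R (\<Sum>s\<in>steps. f (l @ [s]))))"
    unfolding integral_walk_word(2) sum_words_Suc by (simp add: scaleR_sum_right mult.commute)
  then show ?thesis unfolding integral_walk_word(2) [of "\<lambda>l. (1 / 9) *\<^sub>R (\<Sum>s\<in>steps. f (l @ [s]))"] .
qed

lemma prob_walk_word_in: "prob {\<omega> \<in> space P. walk_word n \<omega> \<in> E} = (\<integral>\<omega>. indicator E (walk_word n \<omega>) \<partial>P)"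
proof -
  have "(\<integral>\<omega>. indicator E (walk_word n \<omega>) \<partial>P) = (\<integral>\<omega>. indicator (walk_word n -` E) \<omega> \<partial>P)"
    by (rule arg_cong [where f = "integral\<^sup>L P"]) (auto simp: indicator_def)
  also have "\<dots> = prob (walk_word n -` E \<inter> space P)" by simp
  also have "walk_word n -` E \<inter> space P = {\<omega> \<in> space P. walk_word n \<omega> \<in> E}" by auto
  finally show ?thesis ..
qed

abbreviation walk_tile :: "nat \<Rightarrow> 'a \<Rightarrow> complex set" where
  "walk_tile n \<omega> \<equiv> tile (prod_list (walk_word n \<omega>))"

lemma simple_random_walk_tiles: "simple_random_walk P tile_adj fund_dom walk_tile"
  unfolding simple_random_walk_def
proof (intro conjI allI)
  fix n
  show "walk_tile n \<in> measurable P (count_space UNIV)"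
    by (rule measurable_compose [OF measurable_walk_word]) simp
  show "AE \<omega> in P. walk_tile 0 \<omega> = fund_dom" by (simp add: walk_word_0 tile_one)
next
  fix n :: nat and v :: "nat \<Rightarrow> complex set" and w :: "complex set"
  define E where "E = {l. \<forall>i\<le>n. tile (prod_list (take i l)) = v i}"
  define F where "F = {l. take n l \<in> E \<and> tile (prod_list l) = w}"
  define p where "p = (if tile_adj (v n) w then 1 / real (card {u. tile_adj (v n) u}) else 0)"
  have E: "{\<omega> \<in> space P. \<forall>i\<le>n. walk_tile i \<omega> = v i} = {\<omega> \<in> space P. walk_word n \<omega> \<in> E}"
    by (auto simp: E_def take_walk_word)
  have "take n (walk_word (Suc n) \<omega>) = walk_word n \<omega>" for \<omega> by (simp add: take_walk_word)
  then have F: "{\<omega> \<in> space P. (\<forall>i\<le>n. walk_tile i \<omega> = v i) \<and> walk_tile (Suc n) \<omega> = w} =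
      {\<omega> \<in> space P. walk_word (Suc n) \<omega> \<in> F}"
    by (auto simp: F_def E_def take_walk_word)
  \<comment> \<open>Given the past, exactly one of the nine steps leads to a prescribed neighbour.\<close>
  have step: "(1 / 9) *\<^sub>R (\<Sum>s\<in>steps. indicator F (walk_word n \<omega> @ [s])) = indicator E (walk_word n \<omega>) * p" for \<omega>
  proof (cases "walk_word n \<omega> \<in> E")
    case False
    then show ?thesis by (simp add: F_def indicator_def)
  next
    case True
    define A where "A = prod_list (walk_word n \<omega>)"
    have vn: "v n = tile A" using True by (auto simp: E_def A_def)
    have ind: "indicator F (walk_word n \<omega> @ [s]) = (if tile (A * s) = w then 1 else 0 :: real)" for s
      using True by (simp add: F_def A_def indicator_def)
    show ?thesis
    proof (cases "tile_adj (v n) w")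
      case adj: True
      then obtain t where t: "t \<in> steps" "w = tile (A * t)" by (auto simp: vn tile_adj_iff)
      then have "(\<Sum>s\<in>steps. indicator F (walk_word n \<omega> @ [s])) = (\<Sum>s\<in>steps. if s = t then 1 else 0 :: real)"
        by (intro sum.cong) (auto simp: ind tile_eq_iff psl2z_mult_left_cancel)
      also have "\<dots> = 1" using t finite_steps by simp
      finally show ?thesis using True adj by (simp add: p_def vn card_tile_adj)
    next
      case nadj: False
      then have "tile (A * s) \<noteq> w" if "s \<in> steps" for s using that by (auto simp: vn tile_adj_iff)
      then have "(\<Sum>s\<in>steps. indicator F (walk_word n \<omega> @ [s]) :: real) = 0" by (simp add: ind)
      then show ?thesis using nadj by (simp add: p_def)
    qed
  qed
  show "prob {\<omega> \<in> space P. (\<forall>i\<le>n. walk_tile i \<omega> = v i) \<and> walk_tile (Suc n) \<omega> = w} =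
      prob {\<omega> \<in> space P. \<forall>i\<le>n. walk_tile i \<omega> = v i} * p"
    unfolding E F prob_walk_word_in expectation_walk_word_Suc step by simp
qed

text \<open>The mean potential is nonnegative and decreases at each step by at least \<open>1 / (9 * 64)\<close> of the mean of
  \<open>1 / (c\<^sup>2 + d\<^sup>2)\<close>; telescoping bounds the sum of these means.\<close>

lemma AE_summable_bottom_norm:
  "AE \<omega> in P. summable (\<lambda>n. 1 / real_of_int (bottom_norm (prod_list (walk_word n \<omega>))))"
proof -
  define g where "g = (\<lambda>n. \<integral>\<omega>. bottom_potential (prod_list (walk_word n \<omega>)) \<partial>P)"
  define h where "h = (\<lambda>n. \<integral>\<omega>. 1 / real_of_int (bottom_norm (prod_list (walk_word n \<omega>))) \<partial>P)"
  have step: "h n \<le> 576 * (g n - g (Suc n))" for n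
  proof -
    have "g (Suc n) = (\<integral>\<omega>. (1 / 9) *\<^sub>R (\<Sum>s\<in>steps. bottom_potential (prod_list (walk_word n \<omega>) * s)) \<partial>P)"
      unfolding g_def by (subst expectation_walk_word_Suc) simp
    also have "\<dots> \<le> (\<integral>\<omega>. bottom_potential (prod_list (walk_word n \<omega>)) -
        (1 / 576) * (1 / real_of_int (bottom_norm (prod_list (walk_word n \<omega>)))) \<partial>P)"
    proof (rule integral_mono)
      show "(1 / 9) *\<^sub>R (\<Sum>s\<in>steps. bottom_potential (prod_list (walk_word n \<omega>) * s)) \<le>
          bottom_potential (prod_list (walk_word n \<omega>)) - (1 / 576) * (1 / real_of_int (bottom_norm (prod_list (walk_word n \<omega>))))"
        for \<omega>
        using bottom_potential_drift [of "prod_list (walk_word n \<omega>)"] by simp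
    qed (rule integral_walk_word)+
    also have "\<dots> = g n - (1 / 576) * h n"
      unfolding g_def h_def integral_mult_right_zero [symmetric]
      by (rule Bochner_Integration.integral_diff; rule integral_walk_word)
    finally show ?thesis by simp
  qed
  have sum_le: "(\<Sum>i<n. h i) \<le> 576" for n
  proof -
    have g_bounds: "0 \<le> g n" "g 0 \<le> 1" for n
      using bottom_potential_bounds by (auto simp: g_def walk_word_0 prob_space intro!: integral_nonneg_AE)
    have "(\<Sum>i<n. h i) \<le> (\<Sum>i<n. 576 * (g i - g (Suc i)))" by (intro sum_mono step)
    also have "\<dots> = 576 * (g 0 - g n)"
      unfolding sum_distrib_left [symmetric] sum_lessThan_telescope' ..
    finally show ?thesis using g_bounds(1) [of n] g_bounds(2) by simp
  qed
  define N where "N = (\<lambda>n \<omega>. 1 / real_of_int (bottom_norm (prod_list (walk_word n \<omega>))))"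
  have N: "N n \<omega> \<ge> 0" for n \<omega> using bottom_norm_pos [of "prod_list (walk_word n \<omega>)"] by (simp add: N_def)
  have Nm [measurable]: "N n \<in> borel_measurable P" for n
    unfolding N_def by (rule measurable_walk_word_compose)
  have "(\<integral>\<^sup>+\<omega>. (\<Sum>n. ennreal (N n \<omega>)) \<partial>P) = (\<Sum>n. \<integral>\<^sup>+\<omega>. ennreal (N n \<omega>) \<partial>P)"
    by (rule nn_integral_suminf) measurable
  also have "\<dots> = (\<Sum>n. ennreal (h n))"
  proof (rule suminf_cong)
    fix n
    have "integrable P (N n)" unfolding N_def by (rule integral_walk_word)
    then have "(\<integral>\<^sup>+\<omega>. ennreal (N n \<omega>) \<partial>P) = ennreal (\<integral>\<omega>. N n \<omega> \<partial>P)"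
      by (rule nn_integral_eq_integral) (simp add: N)
    then show "(\<integral>\<^sup>+\<omega>. ennreal (N n \<omega>) \<partial>P) = ennreal (h n)" by (simp only: h_def N_def)
  qed
  also have "\<dots> \<le> ennreal 576"
  proof (rule suminf_le_const)
    fix n
    have "h i \<ge> 0" for i using N by (auto simp: h_def N_def intro!: integral_nonneg_AE)
    then have "(\<Sum>i<n. ennreal (h i)) = ennreal (\<Sum>i<n. h i)" by (simp add: sum_ennreal)
    then show "(\<Sum>i<n. ennreal (h i)) \<le> ennreal 576" using sum_le [of n] by (simp add: ennreal_leI del: ennreal_numeral)
  qed simp
  finally have "(\<integral>\<^sup>+\<omega>. (\<Sum>n. ennreal (N n \<omega>)) \<partial>P) \<noteq> \<infinity>" by (auto simp: top_unique)
  then have "AE \<omega> in P. (\<Sum>n. ennreal (N n \<omega>)) \<noteq> \<infinity>"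
    by (intro nn_integral_PInf_AE) auto
  then show ?thesis
  proof eventually_elim
    case (elim \<omega>)
    then have "summable (\<lambda>n. N n \<omega>)" using N by (intro summable_suminf_not_top) auto
    then show ?case by (simp add: N_def)
  qed
qed

text \<open>Since \<open>A (n + 1) = A n * s\<close> with a uniform step \<open>s\<close> next to the point, stationarity removes the
  last step first, and all steps by induction.\<close>

lemma expectation_pushforward:
  "(\<integral>\<omega>. (\<integral>y. iexp (t * real_mobius (prod_list (walk_word n \<omega>)) y) \<partial>signed_minkowski) \<partial>P) = char signed_minkowski t"
proof (induction n)
  case 0
  have "real_mobius 1 y = y" for y by (simp add: real_mobius_def mobius_one)
  then show ?case by (simp add: walk_word_0 prob_space char_def)
next
  case (Suc n)
  have "(1 / 9) *\<^sub>R (\<Sum>s\<in>steps. \<integral>y. iexp (t * real_mobius (A * s) y) \<partial>signed_minkowski) =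
      (\<integral>y. iexp (t * real_mobius A y) \<partial>signed_minkowski)" for A
    by (subst signed_minkowski_stationary [of "\<lambda>x. iexp (t * x)" 1]) (auto simp: scaleR_conv_of_real)
  then show ?case
    by (subst expectation_walk_word_Suc)
      (simp only: prod_list.append prod_list.Cons prod_list.Nil mult_1_right Suc)
qed

lemma walk_limit:
  assumes z: "Im z > 0"
  shows "\<exists>X\<in>borel_measurable P.
    (AE \<omega> in P. (\<lambda>n. mobius (prod_list (walk_word n \<omega>)) z) \<longlonglongrightarrow> complex_of_real (X \<omega>)) \<and>
    distr P borel X = signed_minkowski"
proof -
  define X where "X = (\<lambda>\<omega>. lim (\<lambda>n. Re (mobius (prod_list (walk_word n \<omega>)) z)))"
  have Xm [measurable]: "X \<in> borel_measurable P"
    unfolding X_def by (rule borel_measurable_lim_metric) (rule measurable_walk_word_compose)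
  have lim: "AE \<omega> in P. (\<lambda>n. mobius (prod_list (walk_word n \<omega>)) z) \<longlonglongrightarrow> complex_of_real (X \<omega>)"
    using AE_summable_bottom_norm AE_M
  proof eventually_elim
    case (elim \<omega>)
    have "\<exists>x. (\<lambda>n. mobius (prod_list (walk_word n \<omega>)) z) \<longlonglongrightarrow> complex_of_real x"
      by (rule walk_converges [OF z, of _ "\<lambda>n. M (Suc n) \<omega>"]) (use elim in \<open>simp_all add: walk_word_Suc\<close>)
    then obtain x where x: "(\<lambda>n. mobius (prod_list (walk_word n \<omega>)) z) \<longlonglongrightarrow> complex_of_real x" by blast
    from tendsto_Re [OF x] have "X \<omega> = x" unfolding X_def by (intro limI) simp
    with x show ?case by simp
  qed
  interpret mu: real_distribution signed_minkowski by (rule real_distribution_signed_minkowski)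
  have "char (distr P borel X) t = char signed_minkowski t" for t
  proof -
    define D where "D = (\<lambda>n \<omega>. \<integral>y. iexp (t * real_mobius (prod_list (walk_word n \<omega>)) y) \<partial>signed_minkowski)"
    have "(\<lambda>n. \<integral>\<omega>. D n \<omega> \<partial>P) \<longlonglongrightarrow> (\<integral>\<omega>. iexp (t * X \<omega>) \<partial>P)"
    proof (rule integral_dominated_convergence [where w = "\<lambda>_. 1"])
      show "D n \<in> borel_measurable P" for n unfolding D_def by (rule measurable_walk_word_compose)
      show "AE \<omega> in P. (\<lambda>n. D n \<omega>) \<longlonglongrightarrow> iexp (t * X \<omega>)"
        using lim AE_summable_bottom_norm
        by eventually_elim (unfold D_def, rule pushforward_concentrates [OF z _ summable_LIMSEQ_zero])
      have "norm (D n \<omega>) \<le> 1" for n \<omega>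
        unfolding D_def
        by (rule order_trans [OF integral_norm_bound]) (use mu.prob_space in simp)
      then show "AE \<omega> in P. norm (D n \<omega>) \<le> 1" for n by simp
    qed auto
    moreover have "(\<integral>\<omega>. D n \<omega> \<partial>P) = char signed_minkowski t" for n
      unfolding D_def by (rule expectation_pushforward)
    ultimately have "(\<integral>\<omega>. iexp (t * X \<omega>) \<partial>P) = char signed_minkowski t"
      by (simp add: LIMSEQ_const_iff)
    then show ?thesis by (simp add: char_def integral_distr)
  qed
  then have "distr P borel X = signed_minkowski"
    by (intro Levy_uniqueness real_distribution_distr mu.real_distribution_axioms ext) auto
  with lim Xm show ?thesis by blast
qed

end

theorem mainTheorem1:
  fixes P :: "'a measure" and M :: "nat \<Rightarrow> 'a \<Rightarrow> psl2z" and z :: complex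
    and V :: "nat \<Rightarrow> 'a \<Rightarrow> complex" and T :: "nat \<Rightarrow> 'a \<Rightarrow> complex set"
  assumes "prob_space P"
    and "prob_space.indep_vars P (\<lambda>_. count_space UNIV) M {1..}"
    and "\<And>k. k \<ge> 1 \<Longrightarrow>
      distr P (count_space UNIV) (M k) = measure_pmf (pmf_of_set steps)"
    and "z \<in> interior fund_dom"
  defines "V \<equiv> \<lambda>n \<omega>. foldr (\<lambda>k. mobius (M k \<omega>)) [1..<Suc n] z"
    and "T \<equiv> \<lambda>n \<omega>. tile (prod_list (map (\<lambda>k. M k \<omega>) [1..<Suc n]))"
  shows "(\<forall>\<omega>\<in>space P. \<forall>n\<ge>1. V n \<omega> \<in> T n \<omega>) \<and>
    simple_random_walk P tile_adj fund_dom T \<and>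
    (\<exists>X \<in> borel_measurable P.
      (AE \<omega> in P. (\<lambda>n. V n \<omega>) \<longlonglongrightarrow> complex_of_real (X \<omega>)) \<and>
      (\<exists>(Q :: (real \<times> real \<times> real) measure) S1 S2 W.
        signs_and_minkowski Q S1 S2 W \<and>
        distr P borel X = distr Q borel (\<lambda>\<omega>. S2 \<omega> * W \<omega> powr S1 \<omega>)))"
proof -
  interpret uniform_walk P M
    using assms(1-3) by (simp add: uniform_walk_def uniform_walk_axioms_def)
  have z: "z \<in> fund_dom" using assms(4) interior_subset by blast
  then have Im: "Im z > 0" using fund_domD by blast
  have V: "V n \<omega> = mobius (prod_list (walk_word n \<omega>)) z" for n \<omega>
    unfolding V_def walk_word_def by (rule foldr_mobius [OF Im])
  have T: "T = walk_tile" unfolding T_def walk_word_def ..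
  have "\<forall>\<omega>\<in>space P. \<forall>n\<ge>1. V n \<omega> \<in> T n \<omega>"
    using z by (simp add: V T tile_def)
  moreover have "simple_random_walk P tile_adj fund_dom T"
    unfolding T by (rule simple_random_walk_tiles)
  moreover have "\<exists>X \<in> borel_measurable P.
      (AE \<omega> in P. (\<lambda>n. V n \<omega>) \<longlonglongrightarrow> complex_of_real (X \<omega>)) \<and>
      (\<exists>(Q :: (real \<times> real \<times> real) measure) S1 S2 W.
        signs_and_minkowski Q S1 S2 W \<and>
        distr P borel X = distr Q borel (\<lambda>\<omega>. S2 \<omega> * W \<omega> powr S1 \<omega>))"
    using walk_limit [OF Im] signs_and_minkowski_sign_space
    unfolding V signed_minkowski_def by blast
  ultimately show ?thesis by blast
qed

end
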